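(* Let $n,d$ be positive integers and let $s$ be a positive integer such that $$ s \le \frac12\left(\binom{n+d}{d}+1\right) - \binom{n+d}{d}^{-1}\binom{n+2d}{2d}. \qquad ( * )$$ (For fixed $d\ge 2$, the right-hand side of $( * )$ grows as $\Theta(n^d)$ as $n\to\infty$.) Then for generically chosen $\{(w_i,z_i)\}_{i=1}^s \in (\mathbb{R}\times\mathbb{R}^n)^{\times s}$ the matrices $\{m_d(z_i)m_d(z_i)^{\mathsf T}\}_{i=1}^s$ are linearly independent and $$ \mathrm{minface}\left(\sum_{i=1}^s w_i^2\, m_d(z_i)m_d(z_i)^{\mathsf T},\ \mathcal{M}^{\mathsf{ps}}_{n+1,2d}\right) = \mathrm{cone}\left(\left\{m_d(z_i)m_d(z_i)^{\mathsf T}\right\}_{i=1}^s\right). $$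
   Context: Multi-indices: $\mathbb{N}^{n}_{\le d}=\{\alpha\in\mathbb{N}^n: |\alpha|\le d\}$ and $\mathbb{N}^{n}_{d}=\{\alpha\in\mathbb{N}^n:|\alpha|=d\}$, ordered by the graded lexicographic order. For $z\in\mathbb{R}^n$, $m_d(z)=(z^\alpha)_{\alpha\in\mathbb{N}^n_{\le d}}\in\mathbb{R}^{\binom{n+d}{d}}$ is the vector of all monomials of degree at most $d$ (first entry $1$). With $\tilde z=[1;z]\in\mathbb{R}^{n+1}$, $m_d(z)=v_d(\tilde z)$, where $v_d(u)=(u^\alpha)_{\alpha\in\mathbb{N}^{n+1}_d}$; i.e. index sets are identified by $\alpha\leftrightarrow(d-|\alpha|,\alpha)$. $\mathbb{S}^N$ is the space of real symmetric $N\times N$ matrices and $\mathbb{S}^N_+$ the cone of positive semidefinite ones. With $N=\binom{n+d}{d}$ and rows/columns indexed by $\mathbb{N}^{n+1}_d$, let $$\mathcal{H}_{n+1,d}=\{X\in\mathbb{S}^N : X_{\alpha,\beta}=X_{\alpha',\beta'}\ \text{for all } \alpha,\beta,\alpha',\beta'\in\mathbb{N}^{n+1}_d \text{ with } \alpha+\beta=\alpha'+\beta'\}$$ and $\mathcal{M}^{\mathsf{ps}}_{n+1,2d}=\mathcal{H}_{n+1,d}\cap\mathbb{S}^N_+$ (the cone of pseudo-moment matrices). For a convex set $C$ and $x\in C$, $\mathrm{minface}(x,C)$ is the minimal face of $C$ containing $x$; $\mathrm{cone}(\cdot)$ is the conic hull (all finite nonnegative combinations). A property holds for generically chosen elements of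 the real vector space $(\mathbb{R}\times\mathbb{R}^n)^{\times s}$ if there is a Zariski-open dense subset on which it holds. *)

theory Defs
  imports "HOL-Analysis.Analysis" "HOL-Library.Landau_Symbols"
begin

text \<open>
  The sets of nonzeros of a polynomial function are closed under binary intersection
  (multiply the polynomials), so the topology they generate has as open sets exactly the
  complements of common zero sets of families of polynomials; see \<open>openin_zariski_iff\<close>.
\<close>

definition zariski :: "'a::real_normed_vector topology" where
  "zariski = topology_generated_by {{x. p x \<noteq> 0} | p. real_polynomial_function p}"

definition generically :: "('a::real_normed_vector \<Rightarrow> bool) \<Rightarrow> bool" where
  "generically P \<longleftrightarrow>
     (\<exists>U. openin zariski U \<and> zariski closure_of U = UNIV \<and> (\<forall>x\<in>U. P x))"

lemma openin_zariski_iff: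
  "openin zariski U \<longleftrightarrow>
     (\<exists>F. (\<forall>p\<in>F. real_polynomial_function p) \<and> U = - {x. \<forall>p\<in>F. p x = 0})"
proof
  assume "openin zariski U"
  then have "generate_topology_on {{x. p x \<noteq> 0} | p. real_polynomial_function p} U"
    by (simp add: zariski_def openin_topology_generated_by_iff)
  then show "\<exists>F. (\<forall>p\<in>F. real_polynomial_function p) \<and> U = - {x. \<forall>p\<in>F. p x = 0}"
  proof induction
    case Empty
    then show ?case by (intro exI[of _ "{}"]) auto
  next
    case (Int a b)
    then obtain F G where F: "\<forall>p\<in>F. real_polynomial_function p" "a = - {x. \<forall>p\<in>F. p x = 0}"
      and G: "\<forall>p\<in>G. real_polynomial_function p" "b = - {x. \<forall>p\<in>G. p x = 0}" by blast
    let ?H = "(\<lambda>(p, q) x. p x * q x) ` (F \<times> G)"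
    have "\<forall>r\<in>?H. real_polynomial_function r"
      using F(1) G(1) by auto
    moreover have "a \<inter> b = - {x. \<forall>r\<in>?H. r x = 0}"
      unfolding F(2) G(2) by auto
    ultimately show ?case by blast
  next
    case (UN K)
    let ?F = "{p. real_polynomial_function p \<and> (\<forall>x. p x \<noteq> 0 \<longrightarrow> x \<in> \<Union> K)}"
    have "\<exists>p\<in>?F. p x \<noteq> 0" if "x \<in> k" "k \<in> K" for x k
    proof -
      from UN.IH[OF \<open>k \<in> K\<close>] obtain F
        where F: "\<forall>p\<in>F. real_polynomial_function p" "k = - {x. \<forall>p\<in>F. p x = 0}" by auto
      from \<open>x \<in> k\<close> obtain p where p: "p \<in> F" "p x \<noteq> 0" unfolding F(2) by auto
      have "y \<in> k" if "p y \<noteq> 0" for y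
        unfolding F(2) using that p(1) by auto
      then have "\<forall>y. p y \<noteq> 0 \<longrightarrow> y \<in> \<Union> K" using \<open>k \<in> K\<close> by blast
      then show ?thesis using p F(1) by blast
    qed
    then have "\<Union> K \<subseteq> - {x. \<forall>p\<in>?F. p x = 0}" by blast
    moreover have "- {x. \<forall>p\<in>?F. p x = 0} \<subseteq> \<Union> K" by blast
    ultimately have "\<Union> K = - {x. \<forall>p\<in>?F. p x = 0}" by (rule equalityI)
    moreover have "\<forall>p\<in>?F. real_polynomial_function p" by simp
    ultimately show ?case by blast
  next
    case (Basis s)
    then obtain p where "real_polynomial_function p" "s = {x. p x \<noteq> 0}" by blast
    then show ?case by (intro exI[of _ "{p}"]) auto
  qed
next
  assume "\<exists>F. (\<forall>p\<in>F. real_polynomial_function p) \<and> U = - {x. \<forall>p\<in>F. p x = 0}"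
  then obtain F where F: "\<forall>p\<in>F. real_polynomial_function p" "U = (\<Union>p\<in>F. {x. p x \<noteq> 0})"
    by auto
  show "openin zariski U"
    unfolding F(2) using F(1)
    by (intro openin_Union) (auto simp: zariski_def intro!: topology_generated_by_Basis)
qed

definition multi_indices :: "nat \<Rightarrow> (nat ^ 'k::finite) set" where
  "multi_indices d = {\<alpha>. (\<Sum>j\<in>UNIV. \<alpha> $ j) = d}"

text \<open>
  The \<open>n + 1\<close> homogeneous variables are indexed by \<open>'n option\<close> with \<open>CARD('n) = n\<close>; the index
  \<open>None\<close> is the homogenizing one. The size \<open>N\<close> of the matrices depends on the number \<open>d\<close>, so the
  rows and columns are indexed by a finite type \<open>'N\<close> together with a labelling \<open>idx\<close> of its
  elements by multi-indices; \<open>idx\<close> is meant to be a bijection onto \<open>multi_indices d\<close>.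
\<close>

definition homogenize :: "real ^ 'n \<Rightarrow> real ^ ('n::finite option)" where
  "homogenize z = (\<chi> j. case j of None \<Rightarrow> 1 | Some i \<Rightarrow> z $ i)"

definition monomials :: "('N \<Rightarrow> nat ^ 'k) \<Rightarrow> real ^ 'k \<Rightarrow> real ^ ('N::finite)" where
  "monomials idx u = (\<chi> a. \<Prod>j\<in>UNIV. (u $ j) ^ (idx a $ j))"

definition moment_vec :: "('N \<Rightarrow> nat ^ ('n option)) \<Rightarrow> real ^ 'n::finite \<Rightarrow> real ^ 'N::finite" where
  "moment_vec idx z = monomials idx (homogenize z)"

lemma moment_vec_nth: "moment_vec idx z $ a = (\<Prod>i\<in>UNIV. (z $ i) ^ (idx a $ Some i))"
  by (simp add: moment_vec_def monomials_def homogenize_def UNIV_option_conv prod.reindex)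

definition outer :: "real ^ 'N \<Rightarrow> real ^ 'N ^ 'N::finite" where
  "outer v = (\<chi> a b. v $ a * v $ b)"

definition psd_cone :: "(real ^ 'N ^ 'N::finite) set" where
  "psd_cone = {X. transpose X = X \<and> (\<forall>v. 0 \<le> v \<bullet> (X *v v))}"

definition hankel_space :: "('N \<Rightarrow> nat ^ 'k::finite) \<Rightarrow> (real ^ 'N ^ 'N::finite) set" where
  "hankel_space idx = {X. transpose X = X \<and>
     (\<forall>a b a' b'. idx a + idx b = idx a' + idx b' \<longrightarrow> X $ a $ b = X $ a' $ b')}"

definition pseudo_moment_cone :: "('N \<Rightarrow> nat ^ 'k::finite) \<Rightarrow> (real ^ 'N ^ 'N::finite) set" where
  "pseudo_moment_cone idx = hankel_space idx \<inter> psd_cone"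

text \<open>
  For convex \<open>C\<close> and \<open>x \<in> C\<close> this is itself a face of \<open>C\<close>. For \<open>x \<notin> C\<close> it is \<open>UNIV\<close>.
\<close>

definition minface :: "'a::real_vector \<Rightarrow> 'a set \<Rightarrow> 'a set" where
  "minface x C = \<Inter> {F. F face_of C \<and> x \<in> F}"

lemma minface_face_of:
  assumes "convex C" "x \<in> C"
  shows "minface x C face_of C"
  unfolding minface_def by (rule face_of_Inter) (use assms face_of_refl in blast)+

lemma convex_pseudo_moment_cone: "convex (pseudo_moment_cone (idx :: 'N::finite \<Rightarrow> nat ^ 'k::finite))"
proof -
  have psd: "0 \<le> v \<bullet> ((s *\<^sub>R X + t *\<^sub>R Y) *v v)"
    if "0 \<le> v \<bullet> (X *v v)" "0 \<le> v \<bullet> (Y *v v)" "0 \<le> s" "0 \<le> t"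
    for s t :: real and X Y :: "real ^ 'N ^ 'N" and v :: "real ^ 'N"
    using that
    by (simp add: matrix_vector_mult_add_rdistrib inner_right_distrib
        scaleR_matrix_vector_assoc[symmetric])
  have hankel: "s *\<^sub>R X + t *\<^sub>R Y \<in> hankel_space idx"
    if "X \<in> hankel_space idx" "Y \<in> hankel_space idx" for s t :: real and X Y
  proof -
    have "X $ a $ b = X $ a' $ b'" "Y $ a $ b = Y $ a' $ b'"
      if "idx a + idx b = idx a' + idx b'" for a b a' b'
      using \<open>X \<in> _\<close> \<open>Y \<in> _\<close> that unfolding hankel_space_def by blast+
    moreover have "X $ a $ b = X $ b $ a" "Y $ a $ b = Y $ b $ a" for a b
      using \<open>X \<in> _\<close> \<open>Y \<in> _\<close> unfolding hankel_space_def transpose_def vec_eq_iff by auto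
    ultimately show ?thesis
      unfolding hankel_space_def transpose_def vec_eq_iff
      by (auto intro!: arg_cong2[where f = "(+)"] arg_cong2[where f = "(*)"])
  qed
  have "convex (hankel_space idx)"
    unfolding convex_def using hankel by blast
  moreover have "convex (psd_cone :: (real ^ 'N ^ 'N) set)"
    unfolding convex_def psd_cone_def using psd
    by (auto simp: transpose_def vec_eq_iff)
  ultimately show ?thesis
    unfolding pseudo_moment_cone_def by (rule convex_Int)
qed

text \<open>
  The library's \<open>conic hull\<close> is closed under nonnegative scaling only; the set of finite
  nonnegative combinations is \<open>convex_cone hull\<close>.
\<close>

lemma convex_cone_hull_finite_combinations:
  "convex_cone hull S =
     {\<Sum>x\<in>T. c x *\<^sub>R x | T c. finite T \<and> T \<subseteq> S \<and> (\<forall>x\<in>T. 0 \<le> c x)}" (is "_ = ?R")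
proof
  show "?R \<subseteq> convex_cone hull S"
  proof clarify
    fix T and c :: "'a \<Rightarrow> real"
    assume "finite T" "T \<subseteq> S" "\<forall>x\<in>T. 0 \<le> c x"
    then show "(\<Sum>x\<in>T. c x *\<^sub>R x) \<in> convex_cone hull S"
      by (induction T)
        (auto intro: convex_cone_hull_contains_0 convex_cone_hull_add convex_cone_hull_mul hull_inc)
  qed
  show "convex_cone hull S \<subseteq> ?R"
  proof (rule hull_minimal)
    show "S \<subseteq> ?R"
    proof
      fix x assume "x \<in> S"
      then show "x \<in> ?R"
        by (intro CollectI exI[of _ "{x}"] exI[of _ "\<lambda>_. 1"]) auto
    qed
    show "convex_cone ?R"
      unfolding convex_cone_iff
    proof (intro conjI ballI allI impI)
      show "0 \<in> ?R" by (auto intro!: exI[of _ "{}"])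
    next
      fix x y assume "x \<in> ?R" "y \<in> ?R"
      then obtain T c T' c' where
        T: "finite T" "T \<subseteq> S" "\<forall>x\<in>T. 0 \<le> c x" "x = (\<Sum>x\<in>T. c x *\<^sub>R x)" and
        T': "finite T'" "T' \<subseteq> S" "\<forall>x\<in>T'. 0 \<le> c' x" "y = (\<Sum>x\<in>T'. c' x *\<^sub>R x)"
        by auto
      let ?c = "\<lambda>x. (if x \<in> T then c x else 0) + (if x \<in> T' then c' x else 0)"
      have "x = (\<Sum>x\<in>T \<union> T'. (if x \<in> T then c x else 0) *\<^sub>R x)"
        unfolding T(4) by (rule sum.mono_neutral_cong_left) (use T T' in auto)
      moreover have "y = (\<Sum>x\<in>T \<union> T'. (if x \<in> T' then c' x else 0) *\<^sub>R x)"
        unfolding T'(4) by (rule sum.mono_neutral_cong_left) (use T T' in auto)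
      ultimately have "x + y = (\<Sum>x\<in>T \<union> T'. ?c x *\<^sub>R x)"
        by (simp only: scaleR_left_distrib sum.distrib)
      then show "x + y \<in> ?R"
        using T T' by (intro CollectI exI[of _ "T \<union> T'"] exI[of _ ?c]) auto
    next
      fix x and r :: real assume "x \<in> ?R" "0 \<le> r"
      then obtain T c where
        "finite T" "T \<subseteq> S" "\<forall>x\<in>T. 0 \<le> c x" "x = (\<Sum>x\<in>T. c x *\<^sub>R x)" by auto
      then show "r *\<^sub>R x \<in> ?R" using \<open>0 \<le> r\<close>
        by (intro CollectI exI[of _ T] exI[of _ "\<lambda>x. r * c x"]) (auto simp: scaleR_sum_right)
    qed
  qed
qed

definition rank_bound :: "nat \<Rightarrow> nat \<Rightarrow> real" where
  "rank_bound n d =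
     1 / 2 * (real ((n + d) choose d) + 1)
       - inverse (real ((n + d) choose d)) * real ((n + 2 * d) choose (2 * d))"

end

(*
  Let v_i = m_d(z_i) and let Q be the space of symmetric matrices orthogonal to the Hankel space,
  so dim Q >= N (N + 1) / 2 - C(n + 2 d, 2 d) >= N s. A matrix Y in the minimal face has its range in
  the span of the v_i, hence Y = sum Z_ab v_a v_b^T, and 0 = q . Y = 2 sum_{a<b} Z_ab q(v_a, v_b) for
  all q in Q. So Y is a nonnegative combination of the v_i v_i^T once the functionals
  q |-> q(v_a, v_b), a < b, are linearly independent on Q.

  For generic points they are, for every space Q with dim Q >= N s, by induction on s. As the vectors
  m_d(z) span R^N, some z satisfies dim Q m_d(z) >= s. Then s - 1 generic points have independent
  evaluations on Q m_d(z), and the induction hypothesis applies to {q in Q. q m_d(z) = 0}, whose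
  dimension is at least N (s - 1). A relation between the functionals involves no pair of old points
  (restrict it to that subspace), and then no pair containing z.
*)

theory Submission
  imports Defs
begin

section \<open>Zariski-generic properties\<close>

lemma real_polynomial_function_finite_roots_line:
  fixes p :: "'a::real_normed_vector \<Rightarrow> real"
  assumes p: "real_polynomial_function p" and "p (a + t0 *\<^sub>R b) \<noteq> 0"
  shows "finite {t. p (a + t *\<^sub>R b) = 0}"
proof -
  have "bounded_linear (\<lambda>t. t *\<^sub>R b)"
    by (rule bounded_linear_scaleR_left)
  then have "polynomial_function (\<lambda>t. a + t *\<^sub>R b)"
    by (intro polynomial_function_add polynomial_function_bounded_linear polynomial_function_const)
  from real_polynomial_function_compose[OF this p]
  obtain c n where c: "p \<circ> (\<lambda>t. a + t *\<^sub>R b) = (\<lambda>t. \<Sum>i\<le>n. c i * t ^ i)"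
    using real_polynomial_function_imp_sum by blast
  then have "p (a + t *\<^sub>R b) = (\<Sum>i\<le>n. c i * t ^ i)" for t
    by (auto simp: fun_eq_iff)
  moreover from this have "\<exists>i\<le>n. c i \<noteq> 0"
    using assms(2) by (metis (no_types, lifting) atMost_iff mult_zero_left sum.neutral)
  ultimately show ?thesis
    by (simp add: polyfun_finite_roots)
qed

lemma real_polynomial_function_common_nonroot:
  fixes p q :: "'a::real_normed_vector \<Rightarrow> real"
  assumes "real_polynomial_function p" "real_polynomial_function q" "p x \<noteq> 0" "q y \<noteq> 0"
  obtains z where "p z \<noteq> 0" "q z \<noteq> 0"
proof -
  have "finite {t. p (x + t *\<^sub>R (y - x)) = 0}" "finite {t. q (x + t *\<^sub>R (y - x)) = 0}"
    using assms by (auto intro: real_polynomial_function_finite_roots_line[of _ _ 0]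
        real_polynomial_function_finite_roots_line[of _ _ 1])
  then have "finite ({t. p (x + t *\<^sub>R (y - x)) = 0} \<union> {t. q (x + t *\<^sub>R (y - x)) = 0})"
    by simp
  then obtain t :: real where "t \<notin> {t. p (x + t *\<^sub>R (y - x)) = 0} \<union> {t. q (x + t *\<^sub>R (y - x)) = 0}"
    using ex_new_if_finite infinite_UNIV_char_0 by blast
  then show ?thesis using that by blast
qed

lemma generically_if_nonroot:
  fixes p :: "'a::real_normed_vector \<Rightarrow> real"
  assumes p: "real_polynomial_function p" "p x \<noteq> 0" and P: "\<And>y. p y \<noteq> 0 \<Longrightarrow> P y"
  shows "generically P"
proof -
  have top: "topspace (zariski :: 'a topology) = UNIV"
  proof -
    have "openin zariski (UNIV :: 'a set)"
      unfolding openin_zariski_iff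
      by (intro exI[of _ "{\<lambda>_. 1}"]) auto
    then show ?thesis
      using openin_subset by fastforce
  qed
  have "openin zariski {y. p y \<noteq> 0}"
    unfolding openin_zariski_iff using p by (intro exI[of _ "{p}"]) auto
  moreover have "zariski closure_of {y. p y \<noteq> 0} = UNIV"
  proof -
    have "\<exists>y. p y \<noteq> 0 \<and> y \<in> T" if T: "openin zariski T" "z \<in> T" for T z
    proof -
      from T obtain F where F: "\<forall>q\<in>F. real_polynomial_function q" "T = - {x. \<forall>q\<in>F. q x = 0}"
        unfolding openin_zariski_iff by blast
      with T obtain q where "q \<in> F" "q z \<noteq> 0" by auto
      with F(1) have "real_polynomial_function q" by blast
      from real_polynomial_function_common_nonroot[where p = p and q = q, OF p(1) this p(2) \<open>q z \<noteq> 0\<close>]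
      obtain y where "p y \<noteq> 0" "q y \<noteq> 0" .
      then show ?thesis using \<open>q \<in> F\<close> F(2) by blast
    qed
    then show ?thesis by (auto simp: in_closure_of top)
  qed
  ultimately show ?thesis
    unfolding generically_def using P by blast
qed

definition indep_on :: "'i set \<Rightarrow> 'q set \<Rightarrow> ('i \<Rightarrow> 'q \<Rightarrow> real) \<Rightarrow> bool" where
  "indep_on I Q \<phi> \<longleftrightarrow> (\<forall>c. (\<forall>q\<in>Q. (\<Sum>i\<in>I. c i * \<phi> i q) = 0) \<longrightarrow> (\<forall>i\<in>I. c i = 0))"

lemma indep_onI:
  "(\<And>c i. (\<And>q. q \<in> Q \<Longrightarrow> (\<Sum>i\<in>I. c i * \<phi> i q) = 0) \<Longrightarrow> i \<in> I \<Longrightarrow> c i = 0) \<Longrightarrow> indep_on I Q \<phi>"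
  unfolding indep_on_def by blast

lemma indep_onD:
  "indep_on I Q \<phi> \<Longrightarrow> (\<And>q. q \<in> Q \<Longrightarrow> (\<Sum>i\<in>I. c i * \<phi> i q) = 0) \<Longrightarrow> i \<in> I \<Longrightarrow> c i = 0"
  unfolding indep_on_def by blast

text \<open>Gaussian elimination replaces a nonvanishing minor: the certificate is the product of the pivots.\<close>

lemma indep_on_polynomial_certificate:
  fixes \<phi> :: "'a::real_normed_vector \<Rightarrow> 'i \<Rightarrow> 'q \<Rightarrow> real"
  assumes "finite I"
    and "\<And>i q. i \<in> I \<Longrightarrow> q \<in> Q \<Longrightarrow> real_polynomial_function (\<lambda>y. \<phi> y i q)"
    and "indep_on I Q (\<phi> x)"
  shows "\<exists>p. real_polynomial_function p \<and> p x \<noteq> 0 \<and> (\<forall>y. p y \<noteq> 0 \<longrightarrow> indep_on I Q (\<phi> y))"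
  using assms
proof (induction I arbitrary: \<phi> rule: finite_induct)
  case empty
  then show ?case by (intro exI[of _ "\<lambda>_. 1"]) (auto simp: indep_on_def)
next
  case (insert i I)
  have "\<exists>u\<in>Q. \<phi> x i u \<noteq> 0"
  proof (rule ccontr)
    assume "\<not> ?thesis"
    then have "(\<Sum>j\<in>insert i I. (if j = i then 1 else 0) * \<phi> x j q) = 0" if "q \<in> Q" for q
      using that by (intro sum.neutral) auto
    from indep_onD[OF insert.prems(2) this, of i] show False by simp
  qed
  then obtain u where u: "u \<in> Q" "\<phi> x i u \<noteq> 0" by blast
  define \<psi> where "\<psi> y j q = \<phi> y i u * \<phi> y j q - \<phi> y j u * \<phi> y i q" for y j q
  have \<psi>_sum: "(\<Sum>j\<in>I. c j * \<psi> y j q)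
      = \<phi> y i u * (\<Sum>j\<in>I. c j * \<phi> y j q) - (\<Sum>j\<in>I. c j * \<phi> y j u) * \<phi> y i q" for c y q
    by (simp add: \<psi>_def right_diff_distrib sum_subtractf sum_distrib_left sum_distrib_right
        ac_simps)
  have "indep_on I Q (\<psi> x)"
  proof (rule indep_onI)
    fix c j assume c: "\<And>q. q \<in> Q \<Longrightarrow> (\<Sum>j\<in>I. c j * \<psi> x j q) = 0" and "j \<in> I"
    define c' where "c' = (\<lambda>k. if k = i then - (\<Sum>j\<in>I. c j * \<phi> x j u) else \<phi> x i u * c k)"
    have "(\<Sum>k\<in>insert i I. c' k * \<phi> x k q) = (\<Sum>j\<in>I. c j * \<psi> x j q)" for q
    proof -
      have "(\<Sum>k\<in>I. c' k * \<phi> x k q) = (\<Sum>k\<in>I. \<phi> x i u * (c k * \<phi> x k q))"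
        using insert.hyps by (intro sum.cong) (auto simp: c'_def)
      then show ?thesis
        using insert.hyps by (simp add: \<psi>_sum c'_def sum_distrib_left)
    qed
    with c have "(\<Sum>k\<in>insert i I. c' k * \<phi> x k q) = 0" if "q \<in> Q" for q
      using that by simp
    from indep_onD[OF insert.prems(2) this, of j] \<open>j \<in> I\<close> have "c' j = 0" by simp
    moreover have "j \<noteq> i" using \<open>j \<in> I\<close> insert.hyps by blast
    ultimately show "c j = 0" using u by (simp add: c'_def)
  qed
  moreover have "real_polynomial_function (\<lambda>y. \<psi> y j q)" if "j \<in> I" "q \<in> Q" for j q
    unfolding \<psi>_def using that u insert.prems(1)
    by (intro real_polynomial_function_diff real_polynomial_function.intros(4)) auto
  ultimately obtain p where p: "real_polynomial_function p" "p x \<noteq> 0"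
    "\<And>y. p y \<noteq> 0 \<Longrightarrow> indep_on I Q (\<psi> y)"
    using insert.IH[of \<psi>] by blast
  have "indep_on (insert i I) Q (\<phi> y)" if y: "p y * \<phi> y i u \<noteq> 0" for y
  proof (rule indep_onI)
    fix c j assume c: "\<And>q. q \<in> Q \<Longrightarrow> (\<Sum>k\<in>insert i I. c k * \<phi> y k q) = 0" and j: "j \<in> insert i I"
    have c': "(\<Sum>k\<in>I. c k * \<phi> y k q) = - (c i * \<phi> y i q)" if "q \<in> Q" for q
      using c[OF that] insert.hyps by simp
    have "(\<Sum>k\<in>I. c k * \<psi> y k q) = 0" if "q \<in> Q" for q
      unfolding \<psi>_sum c'[OF that] c'[OF u(1)] by simp
    from indep_onD[OF p(3) this] y have *: "c k = 0" if "k \<in> I" for k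
      using that by auto
    with c[OF u(1)] insert.hyps have "c i * \<phi> y i u = 0" by simp
    with y * j show "c j = 0" by auto
  qed
  then show ?case
    using p u insert.prems(1)
    by (intro exI[of _ "\<lambda>y. p y * \<phi> y i u"]) (auto)
qed

section \<open>Subspaces cut out by linear equations\<close>

lemma subspace_annihilator:
  fixes W T :: "'a::real_inner set"
  shows "subspace W \<Longrightarrow> subspace {x \<in> W. \<forall>t\<in>T. x \<bullet> t = 0}"
  unfolding subspace_def by (auto simp: inner_add_left)

lemma dim_le_annihilator:
  fixes W T :: "'a::euclidean_space set"
  assumes W: "subspace W" and "finite T"
  shows "dim W \<le> dim {x \<in> W. \<forall>t\<in>T. x \<bullet> t = 0} + card T"
proof -
  have "\<exists>t'\<in>W. \<forall>x\<in>W. x \<bullet> t = x \<bullet> t'" for t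
  proof -
    obtain a b where "a \<in> span W" "\<And>w. w \<in> span W \<Longrightarrow> orthogonal b w" "t = a + b"
      using orthogonal_subspace_decomp_exists by blast
    then show ?thesis
      using W by (intro bexI[of _ a])
        (auto simp: span_eq_iff[THEN iffD2] orthogonal_def inner_add_right inner_commute)
  qed
  then obtain \<pi> where \<pi>: "\<And>t. \<pi> t \<in> W" "\<And>t x. x \<in> W \<Longrightarrow> x \<bullet> t = x \<bullet> \<pi> t" by metis
  have "span (\<pi> ` T) \<subseteq> W" using \<pi>(1) W by (intro span_minimal) auto
  from dim_subspace_orthogonal_to_vectors[OF subspace_span W this]
  have "dim {y \<in> W. \<forall>x\<in>span (\<pi> ` T). orthogonal x y} + dim (\<pi> ` T) = dim W" by simp
  moreover have "x \<bullet> t = 0" if "x \<in> W" "\<forall>v\<in>span (\<pi> ` T). orthogonal v x" "t \<in> T" for x t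
    using that \<pi>(2)[of x t] span_base[of "\<pi> t" "\<pi> ` T"]
    by (metis imageI inner_commute orthogonal_def)
  then have "dim {y \<in> W. \<forall>x\<in>span (\<pi> ` T). orthogonal x y} \<le> dim {x \<in> W. \<forall>t\<in>T. x \<bullet> t = 0}"
    by (intro dim_subset) blast
  moreover have "dim (\<pi> ` T) \<le> card T"
    using \<open>finite T\<close> by (meson card_image_le dim_le_card' finite_imageI le_trans)
  ultimately show ?thesis
    by linarith
qed

lemma ex_indep_on_evaluations:
  fixes m :: "'z \<Rightarrow> 'a::euclidean_space" and L :: "'a set" and S :: "'s::finite set"
  assumes span: "span (range m) = UNIV" and "subspace L" "card S \<le> dim L"
  shows "\<exists>y :: 'z ^ 's. indep_on S L (\<lambda>i l. m (y $ i) \<bullet> l)"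
  using finite[of S] assms(2,3)
proof (induction S arbitrary: L rule: finite_induct)
  case empty
  then show ?case by (simp add: indep_on_def)
next
  case (insert x S)
  have "0 < dim L"
    using insert.hyps insert.prems(2) by simp
  then have "\<not> L \<subseteq> {0}"
    by (metis dim_eq_0 less_irrefl)
  then obtain l0 where l0: "l0 \<in> L" "l0 \<noteq> 0"
    by blast
  have "\<exists>z. m z \<bullet> l0 \<noteq> 0"
  proof (rule ccontr)
    assume "\<not> ?thesis"
    then have "\<forall>z. orthogonal l0 (m z)" by (simp add: orthogonal_def inner_commute)
    then have "orthogonal l0 w" if "w \<in> span (range m)" for w
      using that orthogonal_to_span by blast
    with span l0 show False by (metis UNIV_I orthogonal_self)
  qed
  then obtain z where z: "m z \<bullet> l0 \<noteq> 0" by blast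
  let ?L = "{l \<in> L. \<forall>t\<in>{m z}. l \<bullet> t = 0}"
  have "card S \<le> dim ?L"
    using dim_le_annihilator[OF insert.prems(1), of "{m z}"] insert.prems insert.hyps by simp
  then obtain y :: "'z ^ 's" where y: "indep_on S ?L (\<lambda>i l. m (y $ i) \<bullet> l)"
    using insert.IH subspace_annihilator[OF insert.prems(1)] by blast
  define y' :: "'z ^ 's" where "y' = (\<chi> i. if i = x then z else y $ i)"
  have y'[simp]: "y' $ x = z" "\<And>i. i \<in> S \<Longrightarrow> y' $ i = y $ i"
    using insert.hyps by (auto simp: y'_def)
  have "indep_on (insert x S) L (\<lambda>i l. m (y' $ i) \<bullet> l)"
  proof (rule indep_onI)
    fix c i assume c: "\<And>l. l \<in> L \<Longrightarrow> (\<Sum>i\<in>insert x S. c i * (m (y' $ i) \<bullet> l)) = 0"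
      and i: "i \<in> insert x S"
    have c': "c x * (m z \<bullet> l) + (\<Sum>i\<in>S. c i * (m (y $ i) \<bullet> l)) = 0" if "l \<in> L" for l
      using c[OF that] insert.hyps by (simp cong: sum.cong)
    have "(\<Sum>i\<in>S. c i * (m (y $ i) \<bullet> l)) = 0" if "l \<in> ?L" for l
      using c'[of l] that by (simp add: inner_commute)
    from indep_onD[OF y this] have *: "c k = 0" if "k \<in> S" for k
      using that by blast
    with c'[OF l0(1)] z have "c x = 0" by simp
    with * i show "c i = 0" by blast
  qed
  then show ?case by blast
qed

section \<open>Independent quadratic evaluations at generic points\<close>

definition dyad :: "real ^ 'N \<Rightarrow> real ^ 'N \<Rightarrow> real ^ 'N ^ 'N::finite" where
  "dyad u v = (\<chi> a b. u $ a * v $ b)"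

lemma outer_eq_dyad: "outer v = dyad v v"
  by (simp add: outer_def dyad_def)

lemma inner_dyad: "q \<bullet> dyad u v = u \<bullet> (q *v v)"
  by (simp add: inner_vec_def dyad_def matrix_vector_mult_def sum_distrib_left ac_simps)

lemma dyad_mult: "dyad u v *v x = (v \<bullet> x) *\<^sub>R u"
  by (simp add: dyad_def matrix_vector_mult_def vec_eq_iff inner_vec_def sum_distrib_left ac_simps)

lemma linear_matrix_vector_mult_left: "linear (\<lambda>q :: real ^ 'N ^ 'M. q *v v)"
  by (intro linearI) (simp_all add: matrix_vector_mult_add_rdistrib scaleR_matrix_vector_assoc)

lemma real_polynomial_function_inner_dyad:
  assumes "\<And>a. real_polynomial_function (\<lambda>y. u y $ a)" "\<And>b. real_polynomial_function (\<lambda>y. v y $ b)"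
  shows "real_polynomial_function (\<lambda>y. q \<bullet> dyad (u y) (v y))"
  unfolding inner_vec_def dyad_def vec_lambda_beta inner_real_def
  by (intro real_polynomial_function_sum finite real_polynomial_function.intros(2,4) assms)

lemma real_polynomial_function_inner_const:
  fixes u :: "'a::real_normed_vector \<Rightarrow> real ^ 'N::finite"
  assumes "\<And>a. real_polynomial_function (\<lambda>y. u y $ a)"
  shows "real_polynomial_function (\<lambda>y. u y \<bullet> l)"
  unfolding inner_vec_def inner_real_def
  by (intro real_polynomial_function_sum finite real_polynomial_function.intros(2,4) assms)

lemma ex_large_image:
  fixes m :: "'z \<Rightarrow> real ^ 'N::finite" and Q :: "(real ^ 'N ^ 'N) set"
  assumes span: "span (range m) = UNIV" and Q: "subspace Q" and k: "CARD('N) * k \<le> dim Q"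
  shows "\<exists>z. k \<le> dim ((\<lambda>q. q *v m z) ` Q)"
proof (rule ccontr)
  assume small: "\<not> ?thesis"
  obtain B where B: "B \<subseteq> range m" "independent B" "range m \<subseteq> span B"
    by (rule maximal_independent_subset)
  have spanB: "span B = UNIV"
    using span span_mono[OF B(3)] by (simp add: span_span top.extremum_unique)
  have "finite B" "card B = CARD('N)"
    using B(2) spanB by (auto simp: finiteI_independent)
      (metis dim_UNIV dim_eq_card DIM_cart DIM_real mult.right_neutral dim_span)
  have "\<exists>T. finite T \<and> card T = dim ((\<lambda>q. q *v b) ` Q) \<and> (\<lambda>q. q *v b) ` Q \<subseteq> span T" for b
  proof -
    obtain T where "T \<subseteq> (\<lambda>q. q *v b) ` Q" "independent T" "(\<lambda>q. q *v b) ` Q \<subseteq> span T"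
      "card T = dim ((\<lambda>q. q *v b) ` Q)"
      by (rule basis_exists)
    then show ?thesis using finiteI_independent by blast
  qed
  then obtain T where T: "\<And>b. finite (T b)" "\<And>b. card (T b) = dim ((\<lambda>q. q *v b) ` Q)"
    "\<And>b. (\<lambda>q. q *v b) ` Q \<subseteq> span (T b)" by metis
  define U where "U = (\<Union>b\<in>B. (\<lambda>t. dyad t b) ` T b)"
  have "q = 0" if q: "q \<in> Q" "\<forall>t\<in>U. q \<bullet> t = 0" for q
  proof -
    have "q *v b = 0" if "b \<in> B" for b
    proof -
      have "\<forall>t\<in>T b. orthogonal (q *v b) t"
        using q(2) that by (auto simp: U_def inner_dyad orthogonal_def inner_commute)
      moreover have "q *v b \<in> span (T b)" using T(3) q(1) by blast
      ultimately show ?thesis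
        by (metis orthogonal_self orthogonal_to_span)
    qed
    then have "q *v x = 0 *v x" for x
      using spanB by (intro linear_eq_on[of "(*v) q" "(*v) 0" x B])
        (auto simp: matrix_vector_mul_linear)
    then show "q = 0" by (metis matrix_eq)
  qed
  then have "dim {q \<in> Q. \<forall>t\<in>U. q \<bullet> t = 0} = 0"
    by (subst dim_eq_0) blast
  moreover have "finite U" using T(1) \<open>finite B\<close> by (simp add: U_def)
  ultimately have "dim Q \<le> card U"
    using dim_le_annihilator[OF Q, of U] by linarith
  also have "\<dots> \<le> (\<Sum>b\<in>B. card ((\<lambda>t. dyad t b) ` T b))"
    unfolding U_def using \<open>finite B\<close> by (rule card_UN_le)
  also have "\<dots> \<le> (\<Sum>b\<in>B. k - 1)"
  proof (rule sum_mono)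
    fix b assume "b \<in> B"
    then obtain z where "b = m z" using B(1) by blast
    have "card ((\<lambda>t. dyad t b) ` T b) \<le> card (T b)" using T(1) by (rule card_image_le)
    also have "\<dots> < k" using small \<open>b = m z\<close> by (simp add: T(2) not_le)
    finally show "card ((\<lambda>t. dyad t b) ` T b) \<le> k - 1" by simp
  qed
  also have "\<dots> = CARD('N) * (k - 1)" by (simp add: \<open>card B = _\<close>)
  finally have "CARD('N) * k \<le> CARD('N) * (k - 1)" using k by linarith
  moreover have "0 < k" using small by (metis gr0I le0)
  ultimately show False by simp
qed

text \<open>The injection \<open>e\<close> only serves to list each unordered pair of points once.\<close>

lemma ex_indep_on_pairs:
  fixes m :: "'z::euclidean_space \<Rightarrow> real ^ 'N::finite" and Q :: "(real ^ 'N ^ 'N) set"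
    and S :: "'s::finite set" and e :: "'s \<Rightarrow> nat"
  assumes poly: "\<And>a. real_polynomial_function (\<lambda>z. m z $ a)"
    and span: "span (range m) = UNIV" and "inj e"
    and "subspace Q" "CARD('N) * card S \<le> dim Q"
  shows "\<exists>y :: 'z ^ 's. indep_on {(a, b). a \<in> S \<and> b \<in> S \<and> e a < e b} Q
           (\<lambda>(a, b) q. q \<bullet> dyad (m (y $ a)) (m (y $ b)))"
  using finite[of S] assms(4,5)
proof (induction S arbitrary: Q rule: finite_ranking_induct[where f = e])
  case empty
  then show ?case by (simp add: indep_on_def)
next
  case (insert x S)
  show ?case
  proof (cases "x \<in> S")
    case True
    then show ?thesis using insert.IH insert.prems by (simp add: insert_absorb)
  next
    case False
    have polyc: "real_polynomial_function (\<lambda>y :: 'z ^ 's. m (y $ i) $ a)" for i a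
    proof -
      have "polynomial_function (\<lambda>y :: 'z ^ 's. y $ i)"
        by (intro polynomial_function_bounded_linear bounded_linear_vec_nth)
      from real_polynomial_function_compose[OF this poly] show ?thesis by (simp add: o_def)
    qed
    have lt: "e y < e x" if "y \<in> S" for y
      using that insert.hyps False \<open>inj e\<close> by (metis injD le_neq_implies_less)
    obtain z where z: "card (insert x S) \<le> dim ((\<lambda>q. q *v m z) ` Q)"
      using ex_large_image[OF span insert.prems] by blast
    let ?L = "(\<lambda>q. q *v m z) ` Q"
    let ?T = "range (\<lambda>i. dyad (axis i 1) (m z))"
    let ?Q = "{q \<in> Q. \<forall>t\<in>?T. q \<bullet> t = 0}"
    let ?I = "{(a, b). a \<in> S \<and> b \<in> S \<and> e a < e b}"
    have Q0: "q *v m z = 0" if "q \<in> ?Q" for q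
      using that by (auto simp: inner_dyad inner_axis' vec_eq_iff)
    have "card ?T \<le> CARD('N)" by (metis card_image_le finite)
    then have "CARD('N) * card S \<le> dim ?Q"
      using dim_le_annihilator[OF insert.prems(1), of ?T] insert.prems(2) False by simp
    then obtain y1 :: "'z ^ 's" where y1: "indep_on ?I ?Q
        (\<lambda>(a, b) q. q \<bullet> dyad (m (y1 $ a)) (m (y1 $ b)))"
      using insert.IH[OF subspace_annihilator[OF insert.prems(1)]] by blast
    have "subspace ?L"
      using linear_subspace_image[OF linear_matrix_vector_mult_left insert.prems(1)] .
    moreover have "card S \<le> dim ?L" using z False by simp
    ultimately obtain y2 :: "'z ^ 's" where y2: "indep_on S ?L (\<lambda>i l. m (y2 $ i) \<bullet> l)"
      using ex_indep_on_evaluations[OF span] by blast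
    have "\<exists>p. real_polynomial_function p \<and> p y1 \<noteq> 0 \<and> (\<forall>y. p y \<noteq> 0 \<longrightarrow>
        indep_on ?I ?Q (\<lambda>(a, b) q. q \<bullet> dyad (m (y $ a)) (m (y $ b))))"
      by (rule indep_on_polynomial_certificate[where x = y1 and
            \<phi> = "\<lambda>y (a, b) q. q \<bullet> dyad (m (y $ a)) (m (y $ b))", OF _ _ y1])
        (auto intro!: real_polynomial_function_inner_dyad polyc)
    then obtain p1 where p1: "real_polynomial_function p1" "p1 y1 \<noteq> 0" "\<And>y. p1 y \<noteq> 0 \<Longrightarrow>
        indep_on ?I ?Q (\<lambda>(a, b) q. q \<bullet> dyad (m (y $ a)) (m (y $ b)))" by blast
    have "\<exists>p. real_polynomial_function p \<and> p y2 \<noteq> 0 \<and> (\<forall>y. p y \<noteq> 0 \<longrightarrow>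
        indep_on S ?L (\<lambda>i l. m (y $ i) \<bullet> l))"
      by (rule indep_on_polynomial_certificate[where x = y2 and
            \<phi> = "\<lambda>y i l. m (y $ i) \<bullet> l", OF _ _ y2])
        (auto intro!: real_polynomial_function_inner_const polyc)
    then obtain p2 where p2: "real_polynomial_function p2" "p2 y2 \<noteq> 0" "\<And>y. p2 y \<noteq> 0 \<Longrightarrow>
        indep_on S ?L (\<lambda>i l. m (y $ i) \<bullet> l)" by blast
    obtain y where "p1 y \<noteq> 0" "p2 y \<noteq> 0"
      using real_polynomial_function_common_nonroot[where p = p1 and q = p2, OF p1(1) p2(1) p1(2) p2(2)] .
    note y = p1(3)[OF this(1)] p2(3)[OF this(2)]
    define y' :: "'z ^ 's" where "y' = (\<chi> i. if i = x then z else y $ i)"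
    have y'[simp]: "y' $ x = z" "\<And>i. i \<in> S \<Longrightarrow> y' $ i = y $ i"
      using False by (auto simp: y'_def)
    let ?J = "{(a, b). a \<in> insert x S \<and> b \<in> insert x S \<and> e a < e b}"
    have J: "?J = ?I \<union> (\<lambda>a. (a, x)) ` S"
      using lt by (auto simp: image_iff) (meson less_asym)+
    have "indep_on ?J Q (\<lambda>(a, b) q. q \<bullet> dyad (m (y' $ a)) (m (y' $ b)))"
    proof (rule indep_onI)
      fix c :: "'s \<times> 's \<Rightarrow> real" and ab
      assume c: "\<And>q. q \<in> Q \<Longrightarrow> (\<Sum>ab\<in>?J. c ab *
          (case ab of (a, b) \<Rightarrow> \<lambda>q. q \<bullet> dyad (m (y' $ a)) (m (y' $ b))) q) = 0" and "ab \<in> ?J"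
      have c': "(\<Sum>ab\<in>?I. c ab * (case ab of (a, b) \<Rightarrow> \<lambda>q. q \<bullet> dyad (m (y $ a)) (m (y $ b))) q)
          + (\<Sum>a\<in>S. c (a, x) * (m (y $ a) \<bullet> (q *v m z))) = 0" if "q \<in> Q" for q
      proof -
        have "(\<Sum>ab\<in>?J. c ab * (case ab of (a, b) \<Rightarrow> \<lambda>q. q \<bullet> dyad (m (y' $ a)) (m (y' $ b))) q)
          = (\<Sum>ab\<in>?I. c ab * (case ab of (a, b) \<Rightarrow> \<lambda>q. q \<bullet> dyad (m (y' $ a)) (m (y' $ b))) q)
          + (\<Sum>ab\<in>(\<lambda>a. (a, x)) ` S. c ab * (case ab of (a, b) \<Rightarrow> \<lambda>q. q \<bullet> dyad (m (y' $ a)) (m (y' $ b))) q)"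
          unfolding J by (rule sum.union_disjoint) (use False in auto)
        also have "(\<Sum>ab\<in>?I. c ab * (case ab of (a, b) \<Rightarrow> \<lambda>q. q \<bullet> dyad (m (y' $ a)) (m (y' $ b))) q)
          = (\<Sum>ab\<in>?I. c ab * (case ab of (a, b) \<Rightarrow> \<lambda>q. q \<bullet> dyad (m (y $ a)) (m (y $ b))) q)"
          by (rule sum.cong) auto
        also have "(\<Sum>ab\<in>(\<lambda>a. (a, x)) ` S. c ab * (case ab of (a, b) \<Rightarrow> \<lambda>q. q \<bullet> dyad (m (y' $ a)) (m (y' $ b))) q)
          = (\<Sum>a\<in>S. c (a, x) * (m (y $ a) \<bullet> (q *v m z)))"
          by (subst sum.reindex) (auto simp: inj_on_def inner_dyad)
        finally show ?thesis using c[OF that] by simp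
      qed
      have "(\<Sum>ab\<in>?I. c ab * (case ab of (a, b) \<Rightarrow> \<lambda>q. q \<bullet> dyad (m (y $ a)) (m (y $ b))) q) = 0"
        if "q \<in> ?Q" for q
        using c'[of q] Q0[OF that] that by simp
      from indep_onD[OF y(1) this] have cI: "c ab = 0" if "ab \<in> ?I" for ab
        using that by blast
      have "(\<Sum>ab\<in>?I. c ab * (case ab of (a, b) \<Rightarrow> \<lambda>q. q \<bullet> dyad (m (y $ a)) (m (y $ b))) q) = 0" for q
        using cI by (intro sum.neutral) auto
      with c' have "(\<Sum>a\<in>S. c (a, x) * (m (y $ a) \<bullet> l)) = 0" if "l \<in> ?L" for l
        using that by auto
      from indep_onD[OF y(2) this] have "c (a, x) = 0" if "a \<in> S" for a
        using that by blast
      with cI \<open>ab \<in> ?J\<close> show "c ab = 0" unfolding J by blast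
    qed
    then show ?thesis by blast
  qed
qed

section \<open>Monomials and multi-indices\<close>

text \<open>Dedekind's argument for the independence of characters.\<close>

lemma multiplicative_functions_indep:
  fixes \<kappa> :: "'i \<Rightarrow> 'z \<Rightarrow> real" and f :: "'z \<Rightarrow> 'z \<Rightarrow> 'z"
  assumes "finite I" and mult: "\<And>i x y. \<kappa> i (f x y) = \<kappa> i x * \<kappa> i y"
    and "\<And>i. \<kappa> i e = 1" and "inj_on \<kappa> I"
    and "\<And>x. (\<Sum>i\<in>I. c i * \<kappa> i x) = 0" and "i \<in> I"
  shows "c i = 0"
  using assms(1,4-6)
proof (induction I arbitrary: c i rule: finite_induct)
  case empty
  then show ?case by simp
next
  case (insert k I)
  have *: "c j = 0" if "j \<in> I" for j
  proof -
    have "\<kappa> j \<noteq> \<kappa> k"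
      using insert.prems(1) insert.hyps that by (metis inj_onD insert_iff)
    then obtain y where y: "\<kappa> j y \<noteq> \<kappa> k y" by blast
    have "(\<Sum>i\<in>I. (c i * (\<kappa> i y - \<kappa> k y)) * \<kappa> i x) = 0" for x
    proof -
      have "(\<Sum>i\<in>I. (c i * (\<kappa> i y - \<kappa> k y)) * \<kappa> i x)
        = (\<Sum>i\<in>I. c i * \<kappa> i (f x y)) - \<kappa> k y * (\<Sum>i\<in>I. c i * \<kappa> i x)"
        by (simp add: mult sum_subtractf[symmetric] sum_distrib_left algebra_simps)
      also have "(\<Sum>i\<in>I. c i * \<kappa> i (f x y)) = - (c k * \<kappa> k (f x y))"
        using insert.prems(2)[of "f x y"] insert.hyps by simp
      also have "(\<Sum>i\<in>I. c i * \<kappa> i x) = - (c k * \<kappa> k x)"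
        using insert.prems(2)[of x] insert.hyps by simp
      finally show ?thesis by (simp add: mult)
    qed
    then have "c j * (\<kappa> j y - \<kappa> k y) = 0"
      using insert.IH[of "\<lambda>i. c i * (\<kappa> i y - \<kappa> k y)" j] insert.prems(1) that
      by (meson inj_on_subset subset_insertI)
    with y show ?thesis by simp
  qed
  then have "c k * \<kappa> k e = 0"
    using insert.prems(2)[of e] insert.hyps by simp
  with * insert.prems(3) assms(3) show ?case by auto
qed

lemma multi_indices_eqI:
  fixes \<alpha> \<beta> :: "nat ^ ('n::finite option)"
  assumes "\<alpha> \<in> multi_indices d" "\<beta> \<in> multi_indices d" "\<And>i. \<alpha> $ Some i = \<beta> $ Some i"
  shows "\<alpha> = \<beta>"
proof -
  have "(\<Sum>j\<in>UNIV. \<gamma> $ j) = \<gamma> $ None + (\<Sum>i\<in>UNIV. \<gamma> $ Some i)" for \<gamma> :: "nat ^ ('n option)"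
    by (simp add: UNIV_option_conv sum.reindex)
  with assms have "\<alpha> $ None = \<beta> $ None"
    by (simp add: multi_indices_def)
  with assms(3) show ?thesis
    by (metis (mono_tags) vec_eq_iff option.exhaust)
qed

lemma span_moment_vec:
  fixes idx :: "'N::finite \<Rightarrow> nat ^ ('n::finite option)"
  assumes idx: "inj idx" "range idx \<subseteq> multi_indices d"
  shows "span (range (moment_vec idx)) = UNIV"
proof (rule ccontr)
  assume "span (range (moment_vec idx)) \<noteq> UNIV"
  then obtain c where c: "c \<noteq> 0" "\<And>x. x \<in> span (range (moment_vec idx)) \<Longrightarrow> orthogonal c x"
    using orthogonal_to_subspace_exists_gen[of "range (moment_vec idx)" UNIV]
    by (metis psubsetI span_UNIV subset_UNIV)
  have "c $ a = 0" for a
  proof (rule multiplicative_functions_indep[where I = UNIV and \<kappa> = "\<lambda>a z. moment_vec idx z $ a"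
      and f = "\<lambda>x y. \<chi> i. x $ i * y $ i" and e = "\<chi> i. 1"])
    show "inj (\<lambda>a z. moment_vec idx z $ a)"
    proof (rule injI)
      fix a b assume ab: "(\<lambda>z. moment_vec idx z $ a) = (\<lambda>z. moment_vec idx z $ b)"
      have "idx a $ Some i = idx b $ Some i" for i
      proof -
        have "moment_vec idx (\<chi> j. if j = i then 2 else 1) $ k = 2 ^ (idx k $ Some i)" for k
        proof -
          have "(\<Prod>j\<in>UNIV. (if j = i then 2 else 1 :: real) ^ (idx k $ Some j))
            = (\<Prod>j\<in>UNIV. if j = i then 2 ^ (idx k $ Some j) else 1)"
            by (rule prod.cong) auto
          then show ?thesis by (simp add: moment_vec_nth)
        qed
        then have "(2::real) ^ (idx a $ Some i) = 2 ^ (idx b $ Some i)"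
          using fun_cong[OF ab] by metis
        then show ?thesis by simp
      qed
      then show "a = b"
        using idx by (metis injD multi_indices_eqI range_subsetD)
    qed
    show "(\<Sum>a\<in>UNIV. c $ a * moment_vec idx z $ a) = 0" for z
      using c(2)[of "moment_vec idx z"] by (auto simp: orthogonal_def inner_vec_def intro: span_base)
  qed (auto simp: moment_vec_nth power_mult_distrib prod.distrib)
  then have "c = 0" by (simp add: vec_eq_iff)
  with c show False by simp
qed

lemma finite_card_multi_indices:
  "finite (multi_indices d :: (nat ^ 'k::finite) set) \<and>
   card (multi_indices d :: (nat ^ 'k::finite) set) = (d + CARD('k) - 1) choose d"
proof -
  obtain h where h: "bij_betw h {0..<CARD('k)} (UNIV :: 'k set)"
    using ex_bij_betw_nat_finite finite by blast
  define g where "g = (\<lambda>\<alpha> :: nat ^ 'k. map (\<lambda>i. \<alpha> $ h i) [0..<CARD('k)])"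
  let ?L = "{l :: nat list. size l = CARD('k) \<and> sum_list l = d}"
  have sum: "sum_list (g \<alpha>) = (\<Sum>j\<in>UNIV. \<alpha> $ j)" for \<alpha>
    unfolding g_def interv_sum_list_conv_sum_set_nat
    using sum.reindex_bij_betw[OF h, of "\<lambda>j. \<alpha> $ j"] by simp
  have "bij_betw g (multi_indices d) ?L"
  proof (rule bij_betwI')
    fix \<alpha> \<beta> :: "nat ^ 'k"
    have "\<alpha> = \<beta>" if "g \<alpha> = g \<beta>"
    proof -
      have "\<alpha> $ h i = \<beta> $ h i" if "i \<in> {0..<CARD('k)}" for i
        using \<open>g \<alpha> = g \<beta>\<close> that by (simp add: g_def)
      then show ?thesis
        using h by (metis (no_types) UNIV_I bij_betw_imp_surj_on imageE vec_eq_iff)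
    qed
    then show "(g \<alpha> = g \<beta>) = (\<alpha> = \<beta>)" by blast
  next
    fix \<alpha> :: "nat ^ 'k" assume "\<alpha> \<in> multi_indices d"
    then show "g \<alpha> \<in> ?L" by (simp add: sum multi_indices_def) (simp add: g_def)
  next
    fix l assume l: "l \<in> ?L"
    define \<alpha> :: "nat ^ 'k" where "\<alpha> = (\<chi> j. l ! the_inv_into {0..<CARD('k)} h j)"
    have "g \<alpha> = l"
    proof (rule nth_equalityI)
      fix i assume "i < length (g \<alpha>)"
      then have i: "i < CARD('k)" by (simp add: g_def)
      then have "the_inv_into {0..<CARD('k)} h (h i) = i"
        using h by (intro the_inv_into_f_f) (auto simp: bij_betw_def)
      with i show "g \<alpha> ! i = l ! i" by (simp add: g_def \<alpha>_def)
    qed (use l in \<open>simp add: g_def\<close>)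
    moreover from this l sum[of \<alpha>] have "\<alpha> \<in> multi_indices d" by (simp add: multi_indices_def)
    ultimately show "\<exists>\<alpha>\<in>multi_indices d. l = g \<alpha>" by blast
  qed
  moreover have "card ?L = (d + CARD('k) - 1) choose d"
    by (rule card_length_sum_list)
  moreover have "finite ?L"
  proof (rule finite_subset)
    show "?L \<subseteq> {l. set l \<subseteq> {..d} \<and> length l = CARD('k)}"
      using member_le_sum_list by (auto simp: subset_iff)
    show "finite {l. set l \<subseteq> {..d} \<and> length l = CARD('k)}"
      by (rule finite_lists_length_eq) simp
  qed
  ultimately show ?thesis
    by (simp add: bij_betw_finite bij_betw_same_card)
qed

section \<open>Growth of the bound\<close>

lemma tendsto_choose_over_power:
  "(\<lambda>n. real ((n + k) choose k) / real n ^ k) \<longlonglongrightarrow> 1 / fact k"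
proof -
  have eq: "real ((n + k) choose k) / real n ^ k = (\<Prod>i<k. (real n + real k - real i) / real n) / fact k" for n
    by (simp add: binomial_gbinomial gbinomial_prod_rev prod_dividef atLeast0LessThan)
  have "(\<lambda>n. (real n + real k - real i) / real n) \<longlonglongrightarrow> 1" for i
  proof (rule Lim_transform_eventually)
    show "(\<lambda>n. 1 + (real k - real i) / real n) \<longlonglongrightarrow> 1"
      using tendsto_add[OF tendsto_const lim_const_over_n] by fastforce
    show "\<forall>\<^sub>F n in sequentially. 1 + (real k - real i) / real n = (real n + real k - real i) / real n"
      using eventually_gt_at_top[of 0] by eventually_elim (simp add: field_simps)
  qed
  then have "(\<lambda>n. (\<Prod>i<k. (real n + real k - real i) / real n) / fact k) \<longlonglongrightarrow> (\<Prod>i<k. 1) / fact k"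
    by (intro tendsto_divide tendsto_prod tendsto_const) auto
  then show ?thesis by (simp add: eq)
qed

lemma two_lt_central_binomial:
  assumes "d \<ge> 2"
  shows "2 < (2 * d) choose d"
proof -
  have "(2 * d) choose 1 \<le> (2 * d) choose d"
    by (rule binomial_maximum')
  with assms show ?thesis by simp
qed

lemma rank_bound_bigtheta:
  assumes d: "d \<ge> 2"
  shows "(\<lambda>n. rank_bound n d) \<in> \<Theta>(\<lambda>n. real n ^ d)"
proof -
  let ?N = "\<lambda>n. real ((n + d) choose d)" and ?M = "\<lambda>n. real ((n + 2 * d) choose (2 * d))"
  let ?c = "1 / 2 * (1 / fact d + 0) - (1 / fact (2 * d)) / (1 / fact d) :: real"
  have "(\<lambda>n. 1 / real n ^ d) \<longlonglongrightarrow> 0"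
    using tendsto_power[OF lim_const_over_n[of "1::real"], of d] d by (simp add: power_one_over power_0_left)
  then have lim: "(\<lambda>n. 1 / 2 * (?N n / real n ^ d + 1 / real n ^ d)
      - (?M n / real n ^ (2 * d)) / (?N n / real n ^ d)) \<longlonglongrightarrow> ?c"
    by (intro tendsto_diff tendsto_mult tendsto_add tendsto_divide tendsto_const
        tendsto_choose_over_power) auto
  have eq: "1 / 2 * (?N n / real n ^ d + 1 / real n ^ d)
      - (?M n / real n ^ (2 * d)) / (?N n / real n ^ d) = rank_bound n d / real n ^ d"
    if "n > 0" for n
  proof -
    have "1 / 2 * (N / x + 1 / x) - (M / (x * x)) / (N / x) = (1 / 2 * (N + 1) - inverse N * M) / x"
      if "N \<noteq> 0" "x \<noteq> 0" for N M x :: real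
      using that by (simp add: field_simps)
    from this[of "?N n" "real n ^ d" "?M n"] that show ?thesis
      by (simp add: rank_bound_def mult_2 power_add)
  qed
  have "(\<lambda>n. rank_bound n d / real n ^ d) \<longlonglongrightarrow> ?c"
    by (rule Lim_transform_eventually[OF lim eventually_mono[OF eventually_gt_at_top[of 0] eq]])
  moreover have "?c \<noteq> 0"
  proof -
    have "fact d * fact d * ((2 * d) choose d) = (fact (2 * d) :: nat)"
      using binomial_fact_lemma[of d "2 * d"] by (simp add: mult_2)
    then have "fact d * fact d * real ((2 * d) choose d) = fact (2 * d)"
      by (metis of_nat_fact of_nat_mult)
    moreover have "fact d * fact d * 2 < fact d * fact d * real ((2 * d) choose d)"
      using two_lt_central_binomial[OF d] by (intro mult_strict_left_mono) auto
    ultimately have "fact d * fact d * 2 < (fact (2 * d) :: real)" by simp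
    then show ?thesis by (simp add: field_simps)
  qed
  ultimately show ?thesis by (rule bigthetaI_tendsto[rotated])
qed

section \<open>Symmetric matrices orthogonal to the Hankel space\<close>

lemma sum_symmetric:
  fixes e :: "'s::finite \<Rightarrow> nat" and g :: "'s \<Rightarrow> 's \<Rightarrow> 'a::comm_semiring_1"
  assumes e: "inj e" and g: "\<And>a b. g a b = g b a"
  shows "(\<Sum>a\<in>UNIV. \<Sum>b\<in>UNIV. g a b)
    = 2 * (\<Sum>(a, b)\<in>{(a, b). e a < e b}. g a b) + (\<Sum>a\<in>UNIV. g a a)"
proof -
  let ?P = "{(a, b). e a < e b}" and ?P' = "{(a, b). e b < e a}" and ?D = "range (\<lambda>a :: 's. (a, a))"
  have "(UNIV :: ('s \<times> 's) set) = (?P \<union> ?P') \<union> ?D"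
    using injD[OF e] by (auto simp: image_iff)
  then have "(\<Sum>(a, b)\<in>UNIV \<times> UNIV. g a b) = (\<Sum>(a, b)\<in>(?P \<union> ?P') \<union> ?D. g a b)"
    by simp
  also have "\<dots> = (\<Sum>(a, b)\<in>?P \<union> ?P'. g a b) + (\<Sum>(a, b)\<in>?D. g a b)"
    by (rule sum.union_disjoint) auto
  also have "(\<Sum>(a, b)\<in>?P \<union> ?P'. g a b) = (\<Sum>(a, b)\<in>?P. g a b) + (\<Sum>(a, b)\<in>?P'. g a b)"
    by (rule sum.union_disjoint) auto
  also have "(\<Sum>(a, b)\<in>?P'. g a b) = (\<Sum>(a, b)\<in>?P. g a b)"
    by (rule sum.reindex_bij_witness[where i = prod.swap and j = prod.swap]) (auto simp: g)
  also have "(\<Sum>(a, b)\<in>?D. g a b) = (\<Sum>a\<in>UNIV. g a a)"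
    by (subst sum.reindex) (auto simp: inj_on_def)
  finally show ?thesis
    by (simp add: sum.cartesian_product mult_2)
qed

definition hankel_relations :: "('N::finite \<Rightarrow> nat ^ 'k::finite) \<Rightarrow> (real ^ 'N ^ 'N) set" where
  "hankel_relations idx = {q. transpose q = q \<and> (\<forall>X\<in>hankel_space idx. q \<bullet> X = 0)}"

lemma subspace_hankel_relations: "subspace (hankel_relations idx)"
  unfolding hankel_relations_def subspace_def transpose_def
  by (auto simp: vec_eq_iff inner_add_left)

lemma inner_axis_axis: "q \<bullet> axis a (axis b 1) = (q $ a $ b :: real)"
  by (simp add: inner_axis)

lemma dim_hankel_relations:
  fixes idx :: "'N::finite \<Rightarrow> nat ^ 'k::finite"
  assumes idx: "range idx \<subseteq> multi_indices d"
  shows "CARD('N) * (CARD('N) + 1) \<le> 2 * (dim (hankel_relations idx)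
    + card (multi_indices (2 * d) :: (nat ^ 'k) set))"
proof -
  obtain e :: "'N \<Rightarrow> nat" where e: "inj e"
    using finite_imp_inj_to_nat_seg[of "UNIV :: 'N set"] by auto
  let ?P = "{(a, b). e a < e b}"
  let ?M = "multi_indices (2 * d) :: (nat ^ 'k) set"
  let ?h = "\<lambda>\<gamma>. (\<chi> a b. if idx a + idx b = \<gamma> then 1 else 0) :: real ^ 'N ^ 'N"
  let ?T = "(\<lambda>(a, b). axis a (axis b 1) - axis b (axis a 1)) ` ?P \<union> ?h ` ?M"
  have finM: "finite ?M" using finite_card_multi_indices by blast
  have "card ?T \<le> card ((\<lambda>(a, b). axis a (axis b 1) - axis b (axis a 1) :: real ^ 'N ^ 'N) ` ?P) + card (?h ` ?M)"
    by (rule card_Un_le)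
  also have "\<dots> \<le> card ?P + card ?M"
    by (intro add_mono card_image_le finM) simp
  finally have T: "card ?T \<le> card ?P + card ?M" .
  have "{q \<in> UNIV. \<forall>t\<in>?T. q \<bullet> t = 0} \<subseteq> hankel_relations idx"
  proof
    fix q assume q: "q \<in> {q \<in> UNIV. \<forall>t\<in>?T. q \<bullet> t = 0}"
    then have h: "\<And>\<gamma>. \<gamma> \<in> ?M \<Longrightarrow> q \<bullet> ?h \<gamma> = 0" by blast
    have skew: "q $ a $ b = q $ b $ a" if "e a < e b" for a b
    proof -
      have "axis a (axis b 1) - axis b (axis a 1) \<in> ?T"
        using that by (intro UnI1 image_eqI[of _ _ "(a, b)"]) auto
      with q have "q \<bullet> (axis a (axis b 1) - axis b (axis a 1)) = 0" by blast
      then show ?thesis by (simp add: inner_diff_right inner_axis_axis)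
    qed
    have "q $ a $ b = q $ b $ a" for a b
      using skew[of a b] skew[of b a] injD[OF e, of a b] by (metis nat_neq_iff)
    moreover have "q \<bullet> X = 0" if X: "X \<in> hankel_space idx" for X
    proof -
      have "\<exists>x. \<forall>a b. idx a + idx b = \<gamma> \<longrightarrow> X $ a $ b = x" for \<gamma>
      proof -
        have "X $ a $ b = X $ a' $ b'" if "idx a + idx b = idx a' + idx b'" for a b a' b'
          using X that unfolding hankel_space_def by blast
        then show ?thesis by metis
      qed
      then obtain x where x: "\<And>a b. X $ a $ b = x (idx a + idx b)" by metis
      have M: "idx a + idx b \<in> ?M" for a b
        using idx[THEN subsetD, of "idx a"] idx[THEN subsetD, of "idx b"]
        by (simp add: multi_indices_def sum.distrib)
      have "(\<Sum>\<gamma>\<in>?M. x \<gamma> *\<^sub>R ?h \<gamma>) $ a $ b = X $ a $ b" for a b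
      proof -
        have "(\<Sum>\<gamma>\<in>?M. x \<gamma> *\<^sub>R ?h \<gamma>) $ a $ b = (\<Sum>\<gamma>\<in>?M. if idx a + idx b = \<gamma> then x \<gamma> else 0)"
          by (simp only: sum_component vector_scaleR_component vec_lambda_beta) (rule sum.cong, auto)
        also have "\<dots> = X $ a $ b"
          unfolding x by (subst sum.delta') (simp_all add: finM M)
        finally show ?thesis .
      qed
      then have "X = (\<Sum>\<gamma>\<in>?M. x \<gamma> *\<^sub>R ?h \<gamma>)"
        by (simp only: vec_eq_iff) metis
      then have "q \<bullet> X = (\<Sum>\<gamma>\<in>?M. x \<gamma> * (q \<bullet> ?h \<gamma>))"
        by (simp add: inner_sum_right)
      with h show ?thesis by simp
    qed
    ultimately show "q \<in> hankel_relations idx"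
      by (simp add: hankel_relations_def transpose_def vec_eq_iff)
  qed
  then have "dim {q \<in> UNIV. \<forall>t\<in>?T. q \<bullet> t = 0} \<le> dim (hankel_relations idx)"
    by (rule dim_subset)
  moreover have "finite ?T" using finM by simp
  ultimately have "CARD('N) * CARD('N) \<le> dim (hankel_relations idx) + card ?P + card ?M"
    using dim_le_annihilator[OF subspace_UNIV, of ?T] T by simp
  with sum_symmetric[OF e, of "\<lambda>_ _. 1 :: nat"] show ?thesis by simp
qed

lemma dim_hankel_relations_if_rank_bound:
  fixes idx :: "'N::finite \<Rightarrow> nat ^ ('n::finite option)"
  assumes idx: "bij_betw idx UNIV (multi_indices d)" and s: "real s \<le> rank_bound CARD('n) d"
  shows "CARD('N) * s \<le> dim (hankel_relations idx)" and "s \<le> CARD('N)"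
proof -
  have N: "CARD('N) = (CARD('n) + d) choose d"
    using bij_betw_same_card[OF idx] finite_card_multi_indices[of d, where 'k = "'n option"]
    by (simp add: add.commute)
  have M: "card (multi_indices (2 * d) :: (nat ^ 'n option) set) = (CARD('n) + 2 * d) choose (2 * d)"
    using finite_card_multi_indices[of "2 * d", where 'k = "'n option"] by (simp add: add.commute)
  let ?N = "real CARD('N)" and ?M = "real ((CARD('n) + 2 * d) choose (2 * d))"
  have pos: "?N > 0" by simp
  have "?N * real s \<le> ?N * (1 / 2 * (?N + 1) - inverse ?N * ?M)"
    using s by (intro mult_left_mono) (simp_all add: rank_bound_def N)
  also have "\<dots> = ?N * (?N + 1) / 2 - ?M"
    using pos by (simp add: field_simps)
  finally have s': "?N * real s \<le> ?N * (?N + 1) / 2 - ?M" .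
  have "real (CARD('N) * (CARD('N) + 1)) \<le> real (2 * (dim (hankel_relations idx)
      + ((CARD('n) + 2 * d) choose (2 * d))))"
    using dim_hankel_relations[of idx d] idx
    by (subst of_nat_le_iff) (simp add: bij_betw_def M)
  then have "?N * (?N + 1) \<le> 2 * (real (dim (hankel_relations idx)) + ?M)"
    by (simp add: distrib_left)
  then have "?N * (?N + 1) / 2 - ?M \<le> real (dim (hankel_relations idx))"
    by (simp add: field_simps)
  with s' have "?N * real s \<le> real (dim (hankel_relations idx))"
    by (rule order_trans)
  then show "CARD('N) * s \<le> dim (hankel_relations idx)"
    by (metis of_nat_le_iff of_nat_mult)
  have "?N * (?N + 1) / 2 \<le> ?N * ?N"
    using pos by (simp add: field_simps)
  with s' have "?N * real s \<le> ?N * ?N" by linarith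
  then show "s \<le> CARD('N)" using pos by simp
qed

section \<open>The minimal face\<close>

lemma inner_outer: "q \<bullet> outer v = v \<bullet> (q *v v)"
  by (simp add: outer_eq_dyad inner_dyad)

lemma outer_mult: "outer v *v u = (v \<bullet> u) *\<^sub>R v"
  by (simp add: outer_eq_dyad dyad_mult)

lemma outer_inner_outer: "outer v \<bullet> outer u = (v \<bullet> u)\<^sup>2"
  by (simp add: inner_outer outer_mult inner_commute power2_eq_square)

lemma outer_moment_vec_mem: "outer (moment_vec idx z) \<in> pseudo_moment_cone idx"
proof -
  have "moment_vec idx z $ a * moment_vec idx z $ b
      = (\<Prod>i\<in>UNIV. (z $ i) ^ ((idx a + idx b) $ Some i))" for a b
    by (simp add: moment_vec_nth power_add prod.distrib)
  then have "outer (moment_vec idx z) \<in> hankel_space idx"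
    unfolding hankel_space_def outer_def transpose_def by (auto simp: vec_eq_iff ac_simps)
  moreover have "outer (moment_vec idx z) \<in> psd_cone"
    unfolding psd_cone_def
    by (auto simp: outer_mult inner_commute) (simp add: outer_def transpose_def vec_eq_iff mult.commute)
  ultimately show ?thesis by (simp add: pseudo_moment_cone_def)
qed

lemma convex_cone_pseudo_moment_cone: "convex_cone (pseudo_moment_cone idx)"
proof -
  have "c *\<^sub>R X \<in> pseudo_moment_cone idx" if "X \<in> pseudo_moment_cone idx" "0 \<le> c" for c X
    using that unfolding pseudo_moment_cone_def hankel_space_def psd_cone_def transpose_def
    by (auto simp: vec_eq_iff scaleR_matrix_vector_assoc[symmetric])
  moreover have "0 \<in> pseudo_moment_cone idx"
    unfolding pseudo_moment_cone_def hankel_space_def psd_cone_def transpose_def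
    by (auto simp: vec_eq_iff)
  ultimately show ?thesis
    unfolding convex_cone_def conic_def using convex_pseudo_moment_cone by blast
qed

lemma convex_cone_sum:
  assumes "convex_cone C" "\<And>i. i \<in> I \<Longrightarrow> x i \<in> C" "\<And>i. i \<in> I \<Longrightarrow> 0 \<le> c i"
  shows "(\<Sum>i\<in>I. c i *\<^sub>R x i) \<in> C"
  using assms(2,3)
  by (induction I rule: infinite_finite_induct) (use assms(1) in \<open>auto simp: convex_cone_iff\<close>)

lemma convex_cone_hull_range:
  fixes A :: "'s::finite \<Rightarrow> 'a::real_vector"
  assumes "Y \<in> convex_cone hull (range A)"
  obtains c where "\<And>i. 0 \<le> c i" "Y = (\<Sum>i\<in>UNIV. c i *\<^sub>R A i)"
proof -
  let ?R = "{Y. \<exists>c. (\<forall>i. 0 \<le> c i) \<and> Y = (\<Sum>i\<in>UNIV. c i *\<^sub>R A i)}"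
  have "convex_cone hull (range A) \<subseteq> ?R"
  proof (rule hull_minimal)
    show "range A \<subseteq> ?R"
    proof clarify
      fix i
      show "\<exists>c. (\<forall>i. 0 \<le> c i) \<and> A i = (\<Sum>i\<in>UNIV. c i *\<^sub>R A i)"
        by (intro exI[of _ "\<lambda>j. if j = i then 1 else 0"]) (simp add: if_distrib[of "\<lambda>c. c *\<^sub>R _"] cong: if_cong)
    qed
    show "convex_cone ?R"
      unfolding convex_cone_iff
    proof (intro conjI ballI allI impI)
      show "0 \<in> ?R" by (auto intro!: exI[of _ "\<lambda>_. 0"])
    next
      fix x y assume "x \<in> ?R" "y \<in> ?R"
      then obtain c c' where "\<forall>i. 0 \<le> c i" "x = (\<Sum>i\<in>UNIV. c i *\<^sub>R A i)"
        "\<forall>i. 0 \<le> c' i" "y = (\<Sum>i\<in>UNIV. c' i *\<^sub>R A i)" by auto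
      then show "x + y \<in> ?R"
        by (auto intro!: exI[of _ "\<lambda>i. c i + c' i"] simp: scaleR_left_distrib sum.distrib)
    next
      fix x and r :: real assume "x \<in> ?R" "0 \<le> r"
      then obtain c where "\<forall>i. 0 \<le> c i" "x = (\<Sum>i\<in>UNIV. c i *\<^sub>R A i)" by auto
      with \<open>0 \<le> r\<close> show "r *\<^sub>R x \<in> ?R"
        by (auto intro!: exI[of _ "\<lambda>i. r * c i"] simp: scaleR_sum_right)
    qed
  qed
  with assms that show ?thesis by blast
qed

lemma convex_cone_hull_subset_minface:
  fixes A :: "'s::finite \<Rightarrow> 'a::real_vector"
  assumes C: "convex_cone C" and A: "\<And>i. A i \<in> C" and w: "\<And>i. 0 < w i"
  shows "convex_cone hull (range A) \<subseteq> minface (\<Sum>i\<in>UNIV. w i *\<^sub>R A i) C"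
proof
  fix Y assume "Y \<in> convex_cone hull (range A)"
  then obtain c where c: "\<And>i. 0 \<le> c i" "Y = (\<Sum>i\<in>UNIV. c i *\<^sub>R A i)"
    using convex_cone_hull_range by blast
  let ?X = "\<Sum>i\<in>UNIV. w i *\<^sub>R A i"
  define \<epsilon> where "\<epsilon> = Min (range (\<lambda>i. w i / (c i + 1)))"
  have "\<epsilon> > 0"
    unfolding \<epsilon>_def using w c(1) by (subst Min_gr_iff) (auto intro!: divide_pos_pos add_nonneg_pos)
  have \<epsilon>: "\<epsilon> * c i \<le> w i" for i
  proof -
    have "\<epsilon> \<le> w i / (c i + 1)" unfolding \<epsilon>_def by (rule Min_le) auto
    moreover have "0 < c i + 1" using c(1)[of i] by linarith
    ultimately have "\<epsilon> * (c i + 1) \<le> w i" by (simp add: pos_le_divide_eq)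
    with \<open>\<epsilon> > 0\<close> show ?thesis by (simp add: distrib_left)
  qed
  define W where "W = (1 + \<epsilon>) *\<^sub>R ?X - \<epsilon> *\<^sub>R Y"
  have "W = (\<Sum>i\<in>UNIV. ((1 + \<epsilon>) * w i - \<epsilon> * c i) *\<^sub>R A i)"
    by (simp add: W_def c(2) scaleR_sum_right sum_subtractf scaleR_left_diff_distrib)
  moreover have "0 \<le> (1 + \<epsilon>) * w i - \<epsilon> * c i" for i
    using \<epsilon>[of i] mult_pos_pos[OF \<open>\<epsilon> > 0\<close> w[of i]] by (simp add: distrib_right)
  ultimately have "W \<in> C" using C A by (simp add: convex_cone_sum)
  have "Y \<in> C" unfolding c(2) using C A c(1) by (simp add: convex_cone_sum)
  have "Y \<in> F" if F: "F face_of C" "?X \<in> F" for F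
  proof (cases "W = Y")
    case True
    then have "(1 + \<epsilon>) *\<^sub>R ?X = (1 + \<epsilon>) *\<^sub>R Y" by (simp add: W_def algebra_simps)
    with \<open>\<epsilon> > 0\<close> F show ?thesis by simp
  next
    case False
    have "?X = (1 - \<epsilon> / (1 + \<epsilon>)) *\<^sub>R W + (\<epsilon> / (1 + \<epsilon>)) *\<^sub>R Y"
    proof -
      have "1 - \<epsilon> / (1 + \<epsilon>) = inverse (1 + \<epsilon>)" using \<open>\<epsilon> > 0\<close> by (simp add: field_simps)
      then have "(1 - \<epsilon> / (1 + \<epsilon>)) *\<^sub>R W = ?X - (\<epsilon> / (1 + \<epsilon>)) *\<^sub>R Y"
        using \<open>\<epsilon> > 0\<close> by (simp add: W_def scaleR_right_diff_distrib divide_inverse mult.commute)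
      then show ?thesis by simp
    qed
    moreover have "0 < \<epsilon> / (1 + \<epsilon>)" "\<epsilon> / (1 + \<epsilon>) < 1" using \<open>\<epsilon> > 0\<close> by (simp_all add: field_simps)
    ultimately have "?X \<in> open_segment W Y"
      using False unfolding in_segment by blast
    then show ?thesis
      using face_ofD[OF F(1) _ \<open>W \<in> C\<close> \<open>Y \<in> C\<close> F(2)] by blast
  qed
  then show "Y \<in> minface ?X C" unfolding minface_def by blast
qed

lemma inner_symmetric_matrix:
  fixes X :: "real ^ 'N ^ 'N::finite"
  assumes "transpose X = X"
  shows "u \<bullet> (X *v v) = v \<bullet> (X *v u)"
  by (metis assms dot_lmul_matrix inner_commute vector_transpose_matrix)

lemma psd_cone_kernel:
  assumes X: "X \<in> psd_cone" and u: "u \<bullet> (X *v u) = 0"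
  shows "X *v u = 0"
proof (rule ccontr)
  assume "X *v u \<noteq> 0"
  define v where "v = X *v u"
  define n where "n = v \<bullet> v"
  define a where "a = v \<bullet> (X *v v)"
  have sym: "transpose X = X" and psd: "\<And>x. 0 \<le> x \<bullet> (X *v x)"
    using X by (auto simp: psd_cone_def)
  have "n > 0" using \<open>X *v u \<noteq> 0\<close> by (simp add: n_def v_def)
  have "a \<ge> 0" by (simp add: a_def psd)
  have "u \<bullet> (X *v v) = n"
    using inner_symmetric_matrix[OF sym, of u v] by (simp add: n_def v_def)
  then have expand: "(u + t *\<^sub>R v) \<bullet> (X *v (u + t *\<^sub>R v)) = 2 * t * n + t * t * a" for t
    using u by (simp add: matrix_vector_right_distrib matrix_vector_mult_scaleR inner_add_left
        inner_add_right distrib_left a_def n_def v_def[symmetric])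
  define t where "t = - n / (a + 1)"
  have "2 * t * n + t * t * a = - n * n * (a + 2) / ((a + 1) * (a + 1))"
    using \<open>a \<ge> 0\<close> by (simp add: t_def divide_simps) (simp add: algebra_simps)
  also have "\<dots> < 0"
    using \<open>a \<ge> 0\<close> \<open>n > 0\<close> by (intro divide_neg_pos) (auto simp: mult_neg_pos)
  finally show False using psd[of "u + t *\<^sub>R v"] expand[of t] by simp
qed

lemma psd_face:
  fixes v :: "'s \<Rightarrow> real ^ 'N::finite"
  assumes C: "convex C" "C \<subseteq> psd_cone"
  shows "{Y \<in> C. \<forall>u. (\<forall>i. v i \<bullet> u = 0) \<longrightarrow> u \<bullet> (Y *v u) = 0} face_of C"
    (is "?F face_of C")
proof -
  have comb: "u \<bullet> ((s *\<^sub>R X + t *\<^sub>R Y) *v u) = s * (u \<bullet> (X *v u)) + t * (u \<bullet> (Y *v u))" for u :: "real ^ 'N" and s t X Y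
    by (simp add: matrix_vector_mult_add_rdistrib inner_add_right scaleR_matrix_vector_assoc[symmetric])
  show ?thesis
    unfolding face_of_def
  proof (intro conjI ballI impI)
    show "convex ?F"
      unfolding convex_def using convexD[OF C(1)] by (auto simp: comb)
  next
    fix a b x assume ab: "a \<in> C" "b \<in> C" "x \<in> ?F" "x \<in> open_segment a b"
    then obtain t where t: "0 < t" "t < 1" "x = (1 - t) *\<^sub>R a + t *\<^sub>R b"
      by (auto simp: in_segment)
    have "u \<bullet> (a *v u) = 0 \<and> u \<bullet> (b *v u) = 0" if u: "\<forall>i. v i \<bullet> u = 0" for u
    proof -
      have "0 \<le> u \<bullet> (a *v u)" "0 \<le> u \<bullet> (b *v u)"
        using ab C(2) by (auto simp: psd_cone_def)
      moreover have "(1 - t) * (u \<bullet> (a *v u)) + t * (u \<bullet> (b *v u)) = 0"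
        using ab(3) u unfolding t(3) comb[symmetric] by blast
      ultimately show ?thesis
        using t by (smt (verit) mult_nonneg_nonneg mult_pos_pos)
    qed
    with ab show "a \<in> ?F" "b \<in> ?F" by blast+
  qed blast
qed

lemma dual_vectors:
  fixes v :: "'s::finite \<Rightarrow> 'a::euclidean_space"
  assumes v: "indep_on UNIV UNIV (\<lambda>i u. v i \<bullet> u)"
  obtains \<delta> where "\<And>i j. v j \<bullet> \<delta> i = (if j = i then 1 else 0)"
proof -
  have "inj v"
  proof (rule injI, rule ccontr)
    fix j k assume jk: "v j = v k" "j \<noteq> k"
    have "(\<Sum>i\<in>UNIV. (of_bool (i = j) - of_bool (i = k)) * (v i \<bullet> u)) = 0" for u
      by (simp add: left_diff_distrib sum_subtractf jk)
    from indep_onD[OF v this, of j] jk show False by simp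
  qed
  have "\<exists>u. \<forall>j. v j \<bullet> u = (if j = i then 1 else 0)" for i
  proof -
    let ?S = "v ` (UNIV - {i})"
    obtain y z where y: "y \<in> span ?S" and z: "\<And>w. w \<in> span ?S \<Longrightarrow> orthogonal z w" and vi: "v i = y + z"
      using orthogonal_subspace_decomp_exists by blast
    have "z \<noteq> 0"
    proof
      assume "z = 0"
      with y vi have "v i \<in> span ?S" by simp
      then obtain c where "v i = (\<Sum>x\<in>?S. c x *\<^sub>R x)"
        by (auto simp: span_finite)
      also have "\<dots> = (\<Sum>j\<in>UNIV - {i}. c (v j) *\<^sub>R v j)"
        using \<open>inj v\<close> by (subst sum.reindex) (auto intro: inj_on_subset)
      finally have c: "v i = (\<Sum>j\<in>UNIV - {i}. c (v j) *\<^sub>R v j)" .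
      have "(\<Sum>j\<in>UNIV. (if j = i then - 1 else c (v j)) * (v j \<bullet> u)) = 0" for u
      proof -
        have "(\<Sum>j\<in>UNIV - {i}. (if j = i then - 1 else c (v j)) * (v j \<bullet> u))
            = (\<Sum>j\<in>UNIV - {i}. c (v j) *\<^sub>R v j) \<bullet> u"
          unfolding inner_sum_left by (rule sum.cong) auto
        then show ?thesis by (subst sum.remove[of _ i]) (auto simp: c[symmetric])
      qed
      from indep_onD[OF v this, of i] show False by simp
    qed
    moreover have "v i \<bullet> z = z \<bullet> z"
      using z[OF y] by (simp add: vi inner_add_left orthogonal_def inner_commute[of y])
    moreover have "v j \<bullet> z = 0" if "j \<noteq> i" for j
      using z[OF span_base, of "v j"] that by (auto simp: orthogonal_def inner_commute)
    ultimately show ?thesis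
      by (intro exI[of _ "z /\<^sub>R (z \<bullet> z)"]) auto
  qed
  then show ?thesis using that by metis
qed

lemma inj_independent_outer:
  fixes v :: "'s::finite \<Rightarrow> real ^ 'N::finite"
  assumes \<delta>: "\<And>i j. v j \<bullet> \<delta> i = (if j = i then 1 else 0)"
  shows "inj (\<lambda>i. outer (v i))" and "independent (range (\<lambda>i. outer (v i)))"
proof -
  have \<delta>': "outer (v j) \<bullet> outer (\<delta> i) = (if j = i then 1 else 0)" for i j
    by (simp add: outer_inner_outer \<delta>)
  show inj: "inj (\<lambda>i. outer (v i))"
  proof (rule injI)
    fix i j assume "outer (v i) = outer (v j)"
    with \<delta>'[of i i] \<delta>'[of j i] show "i = j" by (metis zero_neq_one)
  qed
  show "independent (range (\<lambda>i. outer (v i)))"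
  proof
    assume "dependent (range (\<lambda>i. outer (v i)))"
    then obtain c i where c: "c (outer (v i)) \<noteq> 0"
      "(\<Sum>x\<in>range (\<lambda>i. outer (v i)). c x *\<^sub>R x) = 0"
      by (auto simp: dependent_finite)
    then have "(\<Sum>j\<in>UNIV. c (outer (v j)) *\<^sub>R outer (v j)) \<bullet> outer (\<delta> i) = 0"
      by (subst (asm) sum.reindex[OF inj]) simp
    then have "c (outer (v i)) = 0"
      by (simp add: inner_sum_left \<delta>' if_distrib cong: if_cong)
    with c show False by simp
  qed
qed

lemma minface_subset_convex_cone_hull:
  fixes v :: "'s::finite \<Rightarrow> real ^ 'N::finite" and e :: "'s \<Rightarrow> nat"
  assumes \<delta>: "\<And>i j. v j \<bullet> \<delta> i = (if j = i then 1 else 0)" and "inj e"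
    and pairs: "indep_on {(a, b). e a < e b} (hankel_relations idx) (\<lambda>(a, b) q. q \<bullet> dyad (v a) (v b))"
    and C: "\<And>i. outer (v i) \<in> pseudo_moment_cone idx" and w: "\<And>i. 0 \<le> w i"
  shows "minface (\<Sum>i\<in>UNIV. w i *\<^sub>R outer (v i)) (pseudo_moment_cone idx)
    \<subseteq> convex_cone hull (range (\<lambda>i. outer (v i)))"
proof
  let ?X = "\<Sum>i\<in>UNIV. w i *\<^sub>R outer (v i)" and ?C = "pseudo_moment_cone idx"
  let ?F = "{Y \<in> ?C. \<forall>u. (\<forall>i. v i \<bullet> u = 0) \<longrightarrow> u \<bullet> (Y *v u) = 0}"
  fix Y assume Y: "Y \<in> minface ?X ?C"
  have "?F face_of ?C"
    using convex_pseudo_moment_cone by (rule psd_face) (simp add: pseudo_moment_cone_def)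
  moreover have "?X \<in> ?F"
    using convex_cone_sum[OF convex_cone_pseudo_moment_cone, of UNIV "\<lambda>i. outer (v i)" idx w] C w
    by (auto simp: inner_outer[symmetric] inner_sum_left outer_inner_outer)
  ultimately have "Y \<in> ?F" using Y unfolding minface_def by blast
  then have hankel: "Y \<in> hankel_space idx" and psd: "Y \<in> psd_cone"
    by (auto simp: pseudo_moment_cone_def)
  then have sym: "transpose Y = Y" by (simp add: psd_cone_def)
  have kernel: "Y *v u = 0" if "\<And>i. v i \<bullet> u = 0" for u
    using \<open>Y \<in> ?F\<close> that by (intro psd_cone_kernel[OF psd]) blast
  define Z where "Z a b = \<delta> a \<bullet> (Y *v \<delta> b)" for a b
  have Z_sym: "Z a b = Z b a" for a b
    unfolding Z_def by (rule inner_symmetric_matrix[OF sym])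
  have Y_mult: "Y *v x = (\<Sum>a\<in>UNIV. (v a \<bullet> x) *\<^sub>R (Y *v \<delta> a))" for x
  proof -
    have "Y *v (x - (\<Sum>a\<in>UNIV. (v a \<bullet> x) *\<^sub>R \<delta> a)) = 0"
      by (rule kernel) (simp add: inner_diff_right inner_sum_right \<delta> if_distrib cong: if_cong)
    then show ?thesis
      by (simp add: matrix_vector_mult_diff_distrib linear_sum[OF matrix_vector_mul_linear]
          matrix_vector_mult_scaleR)
  qed
  have Y_\<delta>: "Y *v \<delta> a = (\<Sum>b\<in>UNIV. Z a b *\<^sub>R v b)" for a
  proof -
    have "y \<bullet> (Y *v \<delta> a) = y \<bullet> (\<Sum>b\<in>UNIV. Z a b *\<^sub>R v b)" for y
    proof -
      have "y \<bullet> (Y *v \<delta> a) = \<delta> a \<bullet> (Y *v y)"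
        by (rule inner_symmetric_matrix[OF sym])
      also have "\<dots> = (\<Sum>b\<in>UNIV. (v b \<bullet> y) * Z a b)"
        unfolding Y_mult[of y] by (simp add: inner_sum_right Z_def)
      finally show ?thesis by (simp add: inner_sum_right inner_commute mult.commute)
    qed
    then show ?thesis using vector_eq_ldot by blast
  qed
  have Y_eq: "Y = (\<Sum>a\<in>UNIV. \<Sum>b\<in>UNIV. Z a b *\<^sub>R dyad (v b) (v a))"
  proof -
    have mult_sum: "(\<Sum>i\<in>I. B i) *v x = (\<Sum>i\<in>I. B i *v x)" for I x and B :: "'s \<Rightarrow> real ^ 'N ^ 'N"
      by (rule linear_sum[OF linear_matrix_vector_mult_left])
    have "Y *v x = (\<Sum>a\<in>UNIV. \<Sum>b\<in>UNIV. Z a b *\<^sub>R dyad (v b) (v a)) *v x" for x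
      unfolding Y_mult[of x] Y_\<delta>
      by (simp add: mult_sum scaleR_matrix_vector_assoc[symmetric] dyad_mult scaleR_sum_right mult.commute)
    then show ?thesis by (simp add: matrix_eq)
  qed
  have "(\<Sum>ab\<in>{(a, b). e a < e b}. (case ab of (a, b) \<Rightarrow> Z a b) * (case ab of (a, b) \<Rightarrow> \<lambda>q. q \<bullet> dyad (v a) (v b)) q) = 0"
    if q: "q \<in> hankel_relations idx" for q
  proof -
    define g where "g a b = Z a b * (q \<bullet> dyad (v a) (v b))" for a b
    have "transpose q = q" using q by (simp add: hankel_relations_def)
    then have dyad_sym: "q \<bullet> dyad (v a) (v b) = q \<bullet> dyad (v b) (v a)" for a b
      unfolding inner_dyad by (rule inner_symmetric_matrix)
    then have "g a b = g b a" for a b unfolding g_def by (simp add: Z_sym[of a b])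
    from sum_symmetric[OF \<open>inj e\<close> this]
    have "(\<Sum>a\<in>UNIV. \<Sum>b\<in>UNIV. g a b) = 2 * (\<Sum>(a, b)\<in>{(a, b). e a < e b}. g a b) + (\<Sum>a\<in>UNIV. g a a)" .
    moreover have "g a a = 0" for a
      using C[of a] q by (simp add: g_def hankel_relations_def pseudo_moment_cone_def outer_eq_dyad)
    moreover have "(\<Sum>a\<in>UNIV. \<Sum>b\<in>UNIV. g a b) = q \<bullet> Y"
      unfolding g_def by (subst Y_eq) (simp add: inner_sum_right dyad_sym)
    moreover have "q \<bullet> Y = 0"
      using q hankel by (simp add: hankel_relations_def)
    ultimately have "(\<Sum>(a, b)\<in>{(a, b). e a < e b}. g a b) = 0" by simp
    then show ?thesis by (simp add: g_def split_beta)
  qed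
  from indep_onD[OF pairs this] have Z_less: "Z a b = 0" if "e a < e b" for a b
    using that by auto
  have Z0: "Z a b = 0" if "a \<noteq> b" for a b
    using that Z_less[of a b] Z_less[of b a] Z_sym[of a b] injD[OF \<open>inj e\<close>, of a b]
    by (metis nat_neq_iff)
  have "(\<Sum>b\<in>UNIV. Z a b *\<^sub>R dyad (v b) (v a)) = Z a a *\<^sub>R outer (v a)" for a
    by (subst sum.remove[of _ a]) (auto simp: Z0 outer_eq_dyad intro!: sum.neutral)
  then have "Y = (\<Sum>a\<in>UNIV. Z a a *\<^sub>R outer (v a))"
    using Y_eq by simp
  moreover have "0 \<le> Z a a" for a using psd by (simp add: Z_def psd_cone_def)
  ultimately show "Y \<in> convex_cone hull (range (\<lambda>i. outer (v i)))"
    by (simp add: convex_cone_sum convex_cone_convex_cone_hull hull_inc)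
qed

theorem theorem1:
  fixes d :: nat
    and idx :: "'N::finite \<Rightarrow> nat ^ ('n::finite option)"
  assumes "d \<ge> 1"
  shows "(bij_betw idx UNIV (multi_indices d) \<longrightarrow>
          real CARD('s::finite) \<le> rank_bound CARD('n) d \<longrightarrow>
          generically (\<lambda>p :: (real \<times> (real ^ 'n)) ^ 's.
            let w = (\<lambda>i. fst (p $ i)); A = (\<lambda>i. outer (moment_vec idx (snd (p $ i)))) in
              inj A \<and> independent (range A) \<and>
              minface (\<Sum>i\<in>UNIV. (w i)\<^sup>2 *\<^sub>R A i) (pseudo_moment_cone idx)
                = convex_cone hull (range A)))
       \<and> (d \<ge> 2 \<longrightarrow> (\<lambda>n. rank_bound n d) \<in> \<Theta>(\<lambda>n. real n ^ d))"
proof (intro conjI impI)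
  show "(\<lambda>n. rank_bound n d) \<in> \<Theta>(\<lambda>n. real n ^ d)" if "d \<ge> 2"
    using that by (rule rank_bound_bigtheta)
next
  assume idx: "bij_betw idx UNIV (multi_indices d)" and s: "real CARD('s) \<le> rank_bound CARD('n) d"
  obtain e :: "'s \<Rightarrow> nat" where e: "inj e"
    using finite_imp_inj_to_nat_seg[of "UNIV :: 's set"] by auto
  define m :: "real \<times> (real ^ 'n) \<Rightarrow> real ^ 'N" where "m = (\<lambda>p. moment_vec idx (snd p))"
  have poly: "real_polynomial_function (\<lambda>p. m p $ a)" for a
    unfolding m_def moment_vec_nth
    by (intro real_polynomial_function_prod real_polynomial_function_power finite
        real_polynomial_function.intros(1) bounded_linear_compose[OF bounded_linear_vec_nth bounded_linear_snd])
  have polyc: "real_polynomial_function (\<lambda>p :: (real \<times> (real ^ 'n)) ^ 's. m (p $ i) $ a)" for i a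
  proof -
    have "polynomial_function (\<lambda>p :: (real \<times> (real ^ 'n)) ^ 's. p $ i)"
      by (intro polynomial_function_bounded_linear bounded_linear_vec_nth)
    from real_polynomial_function_compose[OF this poly] show ?thesis by (simp add: o_def)
  qed
  have "range m = moment_vec idx ` range (snd :: real \<times> (real ^ 'n) \<Rightarrow> _)"
    by (simp only: m_def image_image)
  then have "range m = range (moment_vec idx)"
    by simp
  then have span: "span (range m) = UNIV"
    using span_moment_vec[of idx d] idx by (simp add: bij_betw_def)
  note dims = dim_hankel_relations_if_rank_bound[OF idx s]
  obtain y1 :: "(real \<times> (real ^ 'n)) ^ 's" where y1: "indep_on {(a, b). e a < e b} (hankel_relations idx)
      (\<lambda>(a, b) q. q \<bullet> dyad (m (y1 $ a)) (m (y1 $ b)))"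
    using ex_indep_on_pairs[OF poly span e subspace_hankel_relations, of UNIV idx] dims(1) by auto
  have "CARD('s) \<le> dim (UNIV :: (real ^ 'N) set)" using dims(2) by simp
  then obtain y2 :: "(real \<times> (real ^ 'n)) ^ 's" where y2: "indep_on UNIV UNIV (\<lambda>i u. m (y2 $ i) \<bullet> u)"
    using ex_indep_on_evaluations[OF span subspace_UNIV, where S = "UNIV :: 's set"] by blast
  have "\<exists>p. real_polynomial_function p \<and> p y1 \<noteq> 0 \<and> (\<forall>y. p y \<noteq> 0 \<longrightarrow>
      indep_on {(a, b). e a < e b} (hankel_relations idx) (\<lambda>(a, b) q. q \<bullet> dyad (m (y $ a)) (m (y $ b))))"
    by (rule indep_on_polynomial_certificate[where x = y1 and
          \<phi> = "\<lambda>y (a, b) q. q \<bullet> dyad (m (y $ a)) (m (y $ b))", OF _ _ y1])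
      (auto intro!: real_polynomial_function_inner_dyad polyc)
  then obtain p1 where p1: "real_polynomial_function p1" "p1 y1 \<noteq> 0" "\<And>y. p1 y \<noteq> 0 \<Longrightarrow>
      indep_on {(a, b). e a < e b} (hankel_relations idx) (\<lambda>(a, b) q. q \<bullet> dyad (m (y $ a)) (m (y $ b)))"
    by blast
  have "\<exists>p. real_polynomial_function p \<and> p y2 \<noteq> 0 \<and> (\<forall>y. p y \<noteq> 0 \<longrightarrow>
      indep_on UNIV UNIV (\<lambda>i u. m (y $ i) \<bullet> u))"
    by (rule indep_on_polynomial_certificate[where x = y2 and
          \<phi> = "\<lambda>y i u. m (y $ i) \<bullet> u", OF _ _ y2])
      (auto intro!: real_polynomial_function_inner_const polyc)
  then obtain p2 where p2: "real_polynomial_function p2" "p2 y2 \<noteq> 0" "\<And>y. p2 y \<noteq> 0 \<Longrightarrow>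
      indep_on UNIV UNIV (\<lambda>i u. m (y $ i) \<bullet> u)" by blast
  define p3 :: "(real \<times> (real ^ 'n)) ^ 's \<Rightarrow> real" where "p3 = (\<lambda>y. \<Prod>i\<in>UNIV. fst (y $ i))"
  have p3: "real_polynomial_function p3" "p3 (\<chi> i. (1, 0)) \<noteq> 0"
    unfolding p3_def
    by (intro real_polynomial_function_prod finite real_polynomial_function.intros(1)
        bounded_linear_compose[OF bounded_linear_fst bounded_linear_vec_nth]) simp
  have p12: "real_polynomial_function (\<lambda>y. p1 y * p2 y)"
    using p1(1) p2(1) by (rule real_polynomial_function.intros(4))
  obtain y3 where "p1 y3 \<noteq> 0" "p2 y3 \<noteq> 0"
    using real_polynomial_function_common_nonroot[where p = p1 and q = p2, OF p1(1) p2(1) p1(2) p2(2)] .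
  then have "p1 y3 * p2 y3 \<noteq> 0" by simp
  obtain y4 where y4: "p1 y4 * p2 y4 \<noteq> 0" "p3 y4 \<noteq> 0"
    using real_polynomial_function_common_nonroot[where p = "\<lambda>y. p1 y * p2 y" and q = p3,
        OF p12 p3(1) \<open>p1 y3 * p2 y3 \<noteq> 0\<close> p3(2)] .
  show "generically (\<lambda>p :: (real \<times> (real ^ 'n)) ^ 's.
            let w = (\<lambda>i. fst (p $ i)); A = (\<lambda>i. outer (moment_vec idx (snd (p $ i)))) in
              inj A \<and> independent (range A) \<and>
              minface (\<Sum>i\<in>UNIV. (w i)\<^sup>2 *\<^sub>R A i) (pseudo_moment_cone idx)
                = convex_cone hull (range A))"
  proof (rule generically_if_nonroot)
    show "real_polynomial_function (\<lambda>y. p1 y * p2 y * p3 y)"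
      using p12 p3(1) by (rule real_polynomial_function.intros(4))
    show "p1 y4 * p2 y4 * p3 y4 \<noteq> 0" using y4 by simp
  next
    fix y assume "p1 y * p2 y * p3 y \<noteq> 0"
    then have nz: "p1 y \<noteq> 0" "p2 y \<noteq> 0" "p3 y \<noteq> 0" by auto
    then have w: "fst (y $ i) \<noteq> 0" for i by (simp add: p3_def)
    obtain \<delta> where \<delta>: "\<And>i j. m (y $ j) \<bullet> \<delta> i = (if j = i then 1 else 0)"
      using dual_vectors[OF p2(3)[OF nz(2)]] by blast
    have C: "outer (m (y $ i)) \<in> pseudo_moment_cone idx" for i
      unfolding m_def by (rule outer_moment_vec_mem)
    have "minface (\<Sum>i\<in>UNIV. (fst (y $ i))\<^sup>2 *\<^sub>R outer (m (y $ i))) (pseudo_moment_cone idx)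
        = convex_cone hull (range (\<lambda>i. outer (m (y $ i))))"
      using w by (intro subset_antisym minface_subset_convex_cone_hull[OF \<delta> e p1(3)[OF nz(1)] C]
          convex_cone_hull_subset_minface convex_cone_pseudo_moment_cone C) auto
    with inj_independent_outer[OF \<delta>]
    show "let w = (\<lambda>i. fst (y $ i)); A = (\<lambda>i. outer (moment_vec idx (snd (y $ i)))) in
              inj A \<and> independent (range A) \<and>
              minface (\<Sum>i\<in>UNIV. (w i)\<^sup>2 *\<^sub>R A i) (pseudo_moment_cone idx)
                = convex_cone hull (range A)"
      by (simp add: Let_def m_def)
  qed
qed

end
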